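(* Let $f:\mathbb{Z}^n \to \mathbb{R}\cup\{+\infty\}$ be a function with nonempty effective domain $\mathrm{dom}\, f = \{x \in \mathbb{Z}^n \mid f(x) < +\infty\}$ such that either (i) $\mathrm{dom}\, f$ is bounded, or (ii) the convex hull of $\mathrm{dom}\, f$ is a polyhedron and $f$ is convex-extensible (i.e., extensible to a locally polyhedral convex function). Then $f$ is multimodular if and only if, for every vector $p \in \mathbb{R}^n$, the set $\arg\min f[-p]$ is a multimodular set, where $f[-p](x) = f(x) - \sum_{i=1}^n p_i x_i$.
   Context: A function $f:\mathbb{Z}^n \to \mathbb{R}\cup\{+\infty\}$ with nonempty effective domain is called multimodular if the function $\tilde f:\mathbb{Z}^{n+1}\to\mathbb{R}\cup\{+\infty\}$ defined by $\tilde f(x_0,x) = f(x_1-x_0, x_2-x_1, \ldots, x_n-x_{n-1})$ ($x_0\in\mathbb{Z}$, $x\in\mathbb{Z}^n$) is submodular, i.e., $\tilde f(u)+\tilde f(v) \ge \tilde f(u\vee v)+\tilde f(u\wedge v)$ for all $u,v$, where $\vee,\wedge$ denote componentwise maximum and minimum. A nonempty set $S\subseteq\mathbb{Z}^n$ is called multimodular if its indicator function ($0$ on $S$, $+\infty$ outside $S$) is multimodular. $\arg\min f[-p]$ denotes the set of minimizers of $f[-p]$.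
   Formalization: The condition is required only for those p with argmin f[-p] nonempty; as multimodular sets are nonempty by definition, the literal claim fails under (ii), e.g. f = 0 on Z^n with p ≠ 0. Under (i) argmin f[-p] is never empty. *)

theory Defs
  imports "HOL-Analysis.Analysis"
begin

(* Z^n is int ^ 'n and R^n is real ^ 'n for an index type 'n that is finite and linearly
   ordered, so that its elements play the role of 1 < 2 < ... < n.
   R \<union> {+\<infinity>} is ereal; the value -\<infinity> is excluded by explicit hypotheses. *)

definition real_vec :: "int ^ 'n \<Rightarrow> real ^ 'n" where
  "real_vec x = (\<chi> i. real_of_int (x $ i))"

definition eff_dom :: "('a \<Rightarrow> ereal) \<Rightarrow> 'a set" where
  "eff_dom f = {x. f x < \<infinity>}"

(* The component x_{i-1} of (x_0, x_1, ..., x_n): it is x_0 if i is the least index. *)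
definition prev_comp :: "int \<Rightarrow> int ^ ('n::{finite,linorder}) \<Rightarrow> 'n \<Rightarrow> int" where
  "prev_comp x0 x i = (if {j. j < i} = {} then x0 else x $ Max {j. j < i})"

(* Z^{n+1} is represented by pairs (x_0, x). *)
definition tilde :: "(int ^ ('n::{finite,linorder}) \<Rightarrow> ereal) \<Rightarrow>
    int \<times> (int ^ ('n::{finite,linorder})) \<Rightarrow> ereal" where
  "tilde f = (\<lambda>(x0, x). f (\<chi> i. x $ i - prev_comp x0 x i))"

definition cw_max :: "int \<times> (int ^ 'n) \<Rightarrow> int \<times> (int ^ 'n) \<Rightarrow> int \<times> (int ^ 'n)" where
  "cw_max u v = (max (fst u) (fst v), \<chi> i. max (snd u $ i) (snd v $ i))"

definition cw_min :: "int \<times> (int ^ 'n) \<Rightarrow> int \<times> (int ^ 'n) \<Rightarrow> int \<times> (int ^ 'n)" where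
  "cw_min u v = (min (fst u) (fst v), \<chi> i. min (snd u $ i) (snd v $ i))"

definition submodular :: "(int \<times> (int ^ 'n) \<Rightarrow> ereal) \<Rightarrow> bool" where
  "submodular h \<longleftrightarrow> (\<forall>u v. h u + h v \<ge> h (cw_max u v) + h (cw_min u v))"

definition multimodular :: "(int ^ ('n::{finite,linorder}) \<Rightarrow> ereal) \<Rightarrow> bool" where
  "multimodular f \<longleftrightarrow>
     (\<forall>x. f x \<noteq> -\<infinity>) \<and> eff_dom f \<noteq> {} \<and> submodular (tilde f)"

definition multimodular_set :: "(int ^ ('n::{finite,linorder})) set \<Rightarrow> bool" where
  "multimodular_set S \<longleftrightarrow> S \<noteq> {} \<and> multimodular (\<lambda>x. if x \<in> S then 0 else \<infinity>)"

(* tilt f p is f[-p]. *)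
definition tilt :: "(int ^ 'n \<Rightarrow> ereal) \<Rightarrow> real ^ 'n \<Rightarrow> int ^ 'n \<Rightarrow> ereal" where
  "tilt f p x = f x - ereal (\<Sum>i\<in>UNIV. p $ i * real_of_int (x $ i))"

definition argmin_set :: "('a \<Rightarrow> ereal) \<Rightarrow> 'a set" where
  "argmin_set h = {x. is_arg_min h (\<lambda>_. True) x}"

definition epi :: "(real ^ 'n \<Rightarrow> ereal) \<Rightarrow> ((real ^ 'n) \<times> real) set" where
  "epi g = {(x, t). g x \<le> ereal t}"

(* Locally polyhedral: the restriction of g to every bounded closed box (with value +\<infinity>
   outside the box) is a polyhedral convex function, i.e. its epigraph is a polyhedron. *)
definition locally_polyhedral_convex :: "(real ^ 'n \<Rightarrow> ereal) \<Rightarrow> bool" where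
  "locally_polyhedral_convex g \<longleftrightarrow>
     (\<forall>x. g x \<noteq> -\<infinity>) \<and> convex (epi g) \<and>
     (\<forall>a b. polyhedron (epi (\<lambda>x. if x \<in> cbox a b then g x else \<infinity>)))"

definition convex_extensible :: "(int ^ 'n \<Rightarrow> ereal) \<Rightarrow> bool" where
  "convex_extensible f \<longleftrightarrow>
     (\<exists>g. locally_polyhedral_convex g \<and> (\<forall>x. g (real_vec x) = f x))"

end

theory Submission
  imports Defs
begin

text \<open>
  Suppose that all sets of minimizers \<open>argmin f[-p]\<close> are multimodular. It suffices to show discrete
  midpoint convexity of \<open>tilde f\<close>: the two roundings of the midpoint of \<open>u\<close> and \<open>v\<close> have at most the
  total value of \<open>u\<close> and \<open>v\<close>. Let \<open>z\<close> be the midpoint in the original coordinates. A multimodular set is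
  described by integer bounds on the consecutive partial sums of its elements, hence contains both
  roundings as soon as its convex hull comes close to \<open>z\<close>. So one needs a vector \<open>p\<close> such that the convex
  hull of \<open>argmin f[-p]\<close> comes close to \<open>z\<close>. A supporting hyperplane of the closed convex hull of the
  epigraph at a point \<open>x\<close> near \<open>z\<close> provides \<open>p\<close>.

  If \<open>dom f\<close> is infinite, the hyperplane might be approached only along lattice points that escape to
  infinity in a direction \<open>d\<close>. Then \<open>f[-p]\<close> does not increase in direction \<open>d\<close>. If \<open>d\<close> is rational,
  \<open>d\<close> is a recession direction of \<open>argmin f[-p]\<close>. For irrational \<open>d\<close> this follows from local
  polyhedrality, Dirichlet approximation, and multimodularity of \<open>argmin f[-q]\<close> for a second vector \<open>q\<close>.
  Hence the partial sum bounds of \<open>argmin f[-p]\<close> also hold at \<open>x\<close>.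
\<close>

section \<open>Partial sum coordinates\<close>

text \<open>Here a point of \<open>Z^{n+1}\<close> is a function on \<open>'n option\<close>, where \<open>None\<close> is the index 0.\<close>

definition pred_opt :: "'n::{finite,linorder} \<Rightarrow> 'n option" where
  "pred_opt i = (if {j. j < i} = {} then None else Some (Max {j. j < i}))"

definition diffs :: "('n::{finite,linorder} option \<Rightarrow> 'a::ab_group_add) \<Rightarrow> 'a ^ ('n::{finite,linorder})" where
  "diffs a = (\<chi> i. a (Some i) - a (pred_opt i))"

definition psum :: "'a::ab_group_add ^ ('n::{finite,linorder}) \<Rightarrow> 'n option \<Rightarrow> 'a" where
  "psum x k = (case k of None \<Rightarrow> 0 | Some i \<Rightarrow> \<Sum>j\<in>{..i}. x $ j)"

lemma psum_None [simp]: "psum x None = 0"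
  by (simp add: psum_def)

lemma psum_Some: "psum x (Some i) = x $ i + psum x (pred_opt i)"
proof (cases "{j. j < i} = {}")
  case True
  then have "{..i} = {i}" by (auto simp: order_le_less)
  then show ?thesis using True by (simp add: psum_def pred_opt_def)
next
  case False
  define m where "m = Max {j. j < i}"
  have m: "m < i" "\<And>j. j < i \<Longrightarrow> j \<le> m" using Max_in[OF _ False] by (simp_all add: m_def)
  then have "{..i} = insert i {..m}" "i \<notin> {..m}" by (auto simp: order_le_less)
  then show ?thesis using False by (auto simp: psum_def pred_opt_def m_def[symmetric])
qed

lemma pred_opt_less: "pred_opt i = Some j \<Longrightarrow> j < i"
  unfolding pred_opt_def by (metis (no_types, lifting) Max_in finite mem_Collect_eq option.inject option.distinct(1))

lemma pred_opt_induct [case_names None Some]: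
  fixes k :: "'n::{finite,linorder} option"
  assumes "P None" and "\<And>i. P (pred_opt i) \<Longrightarrow> P (Some i)"
  shows "P k"
proof -
  have "P (Some i)" for i :: 'n
  proof (induction "card {..<i}" arbitrary: i rule: less_induct)
    case less
    show ?case
    proof (rule assms(2), cases "pred_opt i")
      case (Some j)
      then have "{..<j} \<subset> {..<i}"
        using pred_opt_less[OF Some] by auto
      then have "card {..<j} < card {..<i}" by (intro psubset_card_mono) auto
      with less Some show "P (pred_opt i)" by simp
    qed (simp add: assms(1))
  qed
  then show ?thesis using assms(1) by (cases k) auto
qed

lemma psum_diffs: "psum (diffs a) k = a k - a None"
  by (induction k rule: pred_opt_induct) (simp_all add: psum_Some diffs_def)

lemma diffs_psum: "diffs (psum x) = x"
  by (simp add: diffs_def psum_Some vec_eq_iff)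

lemma psum_add: "psum (x + y) k = psum x k + psum y k"
  and psum_diff: "psum (x - y) k = psum x k - psum y k"
  and psum_uminus: "psum (- x) k = - psum x k"
  by (cases k; simp add: psum_def sum.distrib sum_subtractf sum_negf)+

lemma psum_scaleR: "psum (c *\<^sub>R x) k = c * psum x k" for x :: "real ^ ('n::{finite,linorder})"
  by (cases k; simp add: psum_def sum_distrib_left)

lemma psum_real_vec: "psum (real_vec x) k = real_of_int (psum x k)"
  by (cases k; simp add: psum_def real_vec_def)

lemma diffs_shift: "diffs (\<lambda>i. a i + c) = diffs a"
  by (simp add: diffs_def)

lemma diffs_add: "diffs (\<lambda>i. a i + b i) = diffs a + diffs b"
  and diffs_diff: "diffs (\<lambda>i. a i - b i) = diffs a - diffs b"
  by (simp_all add: diffs_def vec_eq_iff)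

lemma diffs_real_vec: "real_vec (diffs a) = diffs (\<lambda>i. real_of_int (a i))"
  by (simp add: diffs_def real_vec_def vec_eq_iff)

lemma bounded_linear_psum: "bounded_linear (\<lambda>x :: real ^ ('n::{finite,linorder}). psum x k)"
  by (rule linear_conv_bounded_linear[THEN iffD1], rule linearI) (simp_all add: psum_add psum_scaleR)

lemma real_vec_add: "real_vec (x + y) = real_vec x + real_vec y"
  and real_vec_diff: "real_vec (x - y) = real_vec x - real_vec y"
  and real_vec_uminus: "real_vec (- x) = - real_vec x"
  by (simp_all add: real_vec_def vec_eq_iff)

text \<open>The preimage of \<open>S\<close> under \<open>diffs\<close> is a sublattice. In contrast
  to \<open>multimodular_set\<close> the empty set qualifies, so empty sets of minimizers need no
  separate treatment.\<close>

definition lset :: "(int ^ ('n::{finite,linorder})) set \<Rightarrow> bool" where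
  "lset S \<longleftrightarrow> (\<forall>a b. diffs a \<in> S \<longrightarrow> diffs b \<in> S \<longrightarrow>
      diffs (\<lambda>i. max (a i) (b i)) \<in> S \<and> diffs (\<lambda>i. min (a i) (b i)) \<in> S)"

lemma lset_Max:
  assumes "lset S" "finite K" "K \<noteq> {}" "\<And>k. k \<in> K \<Longrightarrow> diffs (a k) \<in> S"
  shows "\<exists>b. diffs b \<in> S \<and> (\<forall>i. (\<forall>k\<in>K. a k i \<le> b i) \<and> (\<exists>k\<in>K. b i = a k i))"
  using assms(2-4)
proof (induction rule: finite_ne_induct)
  case (singleton x)
  then show ?case by (intro exI[of _ "a x"]) auto
next
  case (insert x F)
  then obtain b where b: "diffs b \<in> S" "\<forall>i. (\<forall>k\<in>F. a k i \<le> b i) \<and> (\<exists>k\<in>F. b i = a k i)" by blast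
  have "diffs (\<lambda>i. max (a x i) (b i)) \<in> S"
    using assms(1) b(1) insert.prems by (simp add: lset_def)
  moreover have "(\<forall>k\<in>insert x F. a k i \<le> max (a x i) (b i)) \<and> (\<exists>k\<in>insert x F. max (a x i) (b i) = a k i)" for i
  proof -
    have "\<forall>k\<in>F. a k i \<le> max (a x i) (b i)" using b(2) by (simp add: max.coboundedI2)
    then show ?thesis using b(2) by (auto simp: max_def)
  qed
  ultimately show ?case by blast
qed

lemma lset_Min:
  assumes "lset S" "finite K" "K \<noteq> {}" "\<And>k. k \<in> K \<Longrightarrow> diffs (a k) \<in> S"
  shows "\<exists>b. diffs b \<in> S \<and> (\<forall>i. (\<forall>k\<in>K. b i \<le> a k i) \<and> (\<exists>k\<in>K. b i = a k i))"
  using assms(2-4)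
proof (induction rule: finite_ne_induct)
  case (singleton x)
  then show ?case by (intro exI[of _ "a x"]) auto
next
  case (insert x F)
  then obtain b where b: "diffs b \<in> S" "\<forall>i. (\<forall>k\<in>F. b i \<le> a k i) \<and> (\<exists>k\<in>F. b i = a k i)" by blast
  have "diffs (\<lambda>i. min (a x i) (b i)) \<in> S"
    using assms(1) b(1) insert.prems by (simp add: lset_def)
  moreover have "(\<forall>k\<in>insert x F. min (a x i) (b i) \<le> a k i) \<and> (\<exists>k\<in>insert x F. min (a x i) (b i) = a k i)" for i
    using b(2) by (cases "a x i \<le> b i") (auto simp: min_def intro: order_trans)
  ultimately show ?case by blast
qed

text \<open>Shift the witness for \<open>(i, j)\<close> so that it agrees with \<open>psum r\<close>
  at \<open>i\<close>; it is then at least \<open>psum r\<close> at \<open>j\<close>. The maximum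
  over \<open>j\<close> lies above \<open>psum r\<close> and still agrees with it at
  \<open>i\<close>; the minimum of these over \<open>i\<close> is \<open>psum r\<close>
  itself.\<close>

lemma lset_memI:
  assumes S: "lset S"
    and ex: "\<And>i j. \<exists>s\<in>S. psum r j - psum r i \<le> psum s j - psum s i"
  shows "r \<in> S"
proof -
  define s where "s i j = (SOME s. s \<in> S \<and> psum r j - psum r i \<le> psum s j - psum s i)" for i j
  have s: "s i j \<in> S" "psum r j - psum r i \<le> psum (s i j) j - psum (s i j) i" for i j
    using someI_ex[OF ex[of j i, unfolded Bex_def]] by (simp_all add: s_def)
  define a where "a i j k = psum (s i j) k + (psum r i - psum (s i j) i)" for i j k
  have a: "diffs (a i j) \<in> S" for i j
    using s(1) by (simp add: a_def[abs_def] diffs_shift diffs_psum)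
  have "\<exists>b. diffs b \<in> S \<and> (\<forall>k. (\<forall>j\<in>UNIV. a i j k \<le> b k) \<and> (\<exists>j\<in>UNIV. b k = a i j k))" for i
    by (rule lset_Max[OF S]) (use a in auto)
  then obtain b where b: "\<And>i. diffs (b i) \<in> S" "\<And>i j k. a i j k \<le> b i k" "\<And>i k. \<exists>j. b i k = a i j k"
    by (metis UNIV_I)
  have bi: "b i i = psum r i" for i
    using b(3)[of i i] by (auto simp: a_def)
  have bk: "psum r k \<le> b i k" for i k
    using b(2)[of i k k] s(2)[of k i] by (simp add: a_def)
  have "\<exists>c. diffs c \<in> S \<and> (\<forall>k. (\<forall>i\<in>UNIV. c k \<le> b i k) \<and> (\<exists>i\<in>UNIV. c k = b i k))"
    by (rule lset_Min[OF S]) (use b in auto)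
  then obtain c where c: "diffs c \<in> S" "\<And>i k. c k \<le> b i k" "\<And>k. \<exists>i. c k = b i k"
    by (metis UNIV_I)
  have "c = psum r"
    using bi bk c(2,3) by (metis order_antisym ext)
  then show ?thesis using c(1) by (simp add: diffs_psum)
qed

section \<open>Multimodularity in terms of \<open>diffs\<close>\<close>

lemma tilde_eq_diffs: "tilde f (x0, x) = f (diffs (\<lambda>k. case k of None \<Rightarrow> x0 | Some i \<Rightarrow> x $ i))"
  by (auto simp: tilde_def diffs_def prev_comp_def pred_opt_def intro!: arg_cong[of _ _ f] vec_eq_iff[THEN iffD2])

lemma submodular_tilde_iff:
  fixes f :: "int ^ ('n::{finite,linorder}) \<Rightarrow> ereal"
  shows "submodular (tilde f) \<longleftrightarrow> (\<forall>a b. f (diffs (\<lambda>i. max (a i) (b i))) + f (diffs (\<lambda>i. min (a i) (b i)))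
      \<le> f (diffs a) + f (diffs b))"
proof -
  define h :: "int \<times> (int ^ ('n::{finite,linorder})) \<Rightarrow> 'n option \<Rightarrow> int" where
    "h = (\<lambda>u k. case k of None \<Rightarrow> fst u | Some i \<Rightarrow> snd u $ i)"
  have t: "tilde f u = f (diffs (h u))" for u
    by (cases u) (simp add: tilde_eq_diffs h_def)
  have mx: "h (cw_max u v) = (\<lambda>i. max (h u i) (h v i))" "h (cw_min u v) = (\<lambda>i. min (h u i) (h v i))" for u v
    by (auto simp: h_def cw_max_def cw_min_def split: option.splits)
  have "\<exists>u. h u = a" for a
    by (rule exI[of _ "(a None, \<chi> i. a (Some i))"]) (auto simp: h_def split: option.splits)
  then show ?thesis unfolding submodular_def t mx by metis
qed

lemma multimodular_set_imp_lset: "multimodular_set S \<Longrightarrow> lset S"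
  unfolding multimodular_set_def multimodular_def submodular_tilde_iff lset_def
  by (intro allI impI conjI; elim conjE allE; fastforce split: if_splits)

lemma lset_imp_multimodular_set: "lset S \<Longrightarrow> S \<noteq> {} \<Longrightarrow> multimodular_set S"
  unfolding multimodular_set_def multimodular_def submodular_tilde_iff lset_def eff_dom_def
  by auto

section \<open>Discrete midpoint convexity\<close>

text \<open>Replacing \<open>b\<close> by the rounded-up midpoint of \<open>a\<close> and \<open>b\<close> repeatedly ends at \<open>max a (min b (a + 1))\<close>.\<close>

lemma round_up_closed:
  fixes a b :: "'i::finite \<Rightarrow> int"
  assumes mid: "\<And>a b. a \<in> X \<Longrightarrow> b \<in> X \<Longrightarrow> (\<lambda>i. (a i + b i + 1) div 2) \<in> X"
    and "a \<in> X" "b \<in> X"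
  shows "(\<lambda>i. max (a i) (min (b i) (a i + 1))) \<in> X"
  using assms(3)
proof (induction "\<Sum>i\<in>UNIV. nat \<bar>a i - b i\<bar>" arbitrary: b rule: less_induct)
  case less
  let ?b = "\<lambda>i. (a i + b i + 1) div 2"
  show ?case
  \<comment> \<open>Rounding up fixes exactly the differences 0 and 1, since it sends
    \<open>a i - 1\<close> to \<open>a i\<close> but \<open>a i + 1\<close> to itself; every other
    difference shrinks strictly.\<close>
  proof (cases "\<forall>i. b i \<in> {a i, a i + 1}")
    case True
    then have "(\<lambda>i. max (a i) (min (b i) (a i + 1))) = b" by (intro ext) (smt (verit) insert_iff empty_iff)
    then show ?thesis using less by simp
  next
    case False
    then obtain j where j: "b j \<noteq> a j" "b j \<noteq> a j + 1" by auto
    have "(\<Sum>i\<in>UNIV. nat \<bar>a i - ?b i\<bar>) < (\<Sum>i\<in>UNIV. nat \<bar>a i - b i\<bar>)"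
    proof (rule sum_strict_mono_ex1)
      show "\<forall>i\<in>UNIV. nat \<bar>a i - ?b i\<bar> \<le> nat \<bar>a i - b i\<bar>" by auto
      show "\<exists>i\<in>UNIV. nat \<bar>a i - ?b i\<bar> < nat \<bar>a i - b i\<bar>"
        using j by (intro bexI[of _ j]) (presburger | simp)+
    qed simp
    from less(1)[OF this mid[OF assms(2) less(2)]]
    have "(\<lambda>i. max (a i) (min (?b i) (a i + 1))) \<in> X" .
    moreover have "max (a i) (min (?b i) (a i + 1)) = max (a i) (min (b i) (a i + 1))" for i
      by presburger
    ultimately show ?thesis by simp
  qed
qed

text \<open>\<open>a\<close> climbs to \<open>max a b\<close> by unit steps: each coordinate below
  \<open>b\<close> is raised by one, the others stay, and \<open>round_up_closed\<close> keeps the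
  result in \<open>X\<close>.\<close>

lemma max_closed:
  fixes a b :: "'i::finite \<Rightarrow> int"
  assumes mid: "\<And>a b. a \<in> X \<Longrightarrow> b \<in> X \<Longrightarrow> (\<lambda>i. (a i + b i + 1) div 2) \<in> X"
    and "a \<in> X" "b \<in> X"
  shows "(\<lambda>i. max (a i) (b i)) \<in> X"
  using assms(2)
proof (induction "\<Sum>i\<in>UNIV. nat (b i - a i)" arbitrary: a rule: less_induct)
  case less
  let ?a = "\<lambda>i. max (a i) (min (b i) (a i + 1))"
  show ?case
  proof (cases "\<forall>i. b i \<le> a i")
    case True
    then have "(\<lambda>i. max (a i) (b i)) = a" by auto
    then show ?thesis using less by simp
  next
    case False
    then obtain j where j: "b j > a j" by (auto simp: not_le)
    have "(\<Sum>i\<in>UNIV. nat (b i - ?a i)) < (\<Sum>i\<in>UNIV. nat (b i - a i))"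
    proof (rule sum_strict_mono_ex1)
      show "\<exists>i\<in>UNIV. nat (b i - ?a i) < nat (b i - a i)"
        using j by (intro bexI[of _ j]) auto
    qed auto
    from less(1)[OF this round_up_closed[OF mid less(2) assms(3)]]
    have "(\<lambda>i. max (?a i) (b i)) \<in> X" .
    moreover have "max (?a i) (b i) = max (a i) (b i)" for i by linarith
    ultimately show ?thesis by simp
  qed
qed

text \<open>Negation exchanges the two roundings as well as min and max, so
  \<open>max_closed\<close> applies to the reflected set.\<close>

lemma min_closed:
  fixes a b :: "'i::finite \<Rightarrow> int"
  assumes mid: "\<And>a b. a \<in> X \<Longrightarrow> b \<in> X \<Longrightarrow> (\<lambda>i. (a i + b i) div 2) \<in> X"
    and "a \<in> X" "b \<in> X"
  shows "(\<lambda>i. min (a i) (b i)) \<in> X"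
proof -
  define Y where "Y = {a. (\<lambda>i. - a i) \<in> X}"
  have "(\<lambda>i. max (- a i) (- b i)) \<in> Y"
  proof (rule max_closed)
    fix a b :: "'i \<Rightarrow> int" assume "a \<in> Y" "b \<in> Y"
    then have "(\<lambda>i. (- a i + - b i) div 2) \<in> X" using mid[of "\<lambda>i. - a i" "\<lambda>i. - b i"] by (simp add: Y_def)
    moreover have "(- a i + - b i) div 2 = - ((a i + b i + 1) div 2)" for i by presburger
    ultimately show "(\<lambda>i. (a i + b i + 1) div 2) \<in> Y" by (simp add: Y_def)
  qed (use assms in \<open>simp_all add: Y_def\<close>)
  moreover have "- max (- a i) (- b i) = min (a i) (b i)" for i by linarith
  ultimately show ?thesis by (simp add: Y_def)
qed

text \<open>The hypothesis says that the increment of \<open>G\<close> in \<open>l\<close> does not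
  grow with \<open>k\<close>; summing over the unit squares of a grid gives the inequality for its
  corners.\<close>

lemma square_telescope:
  fixes G :: "nat \<Rightarrow> nat \<Rightarrow> real"
  assumes "\<And>k l. G k l + G (Suc k) (Suc l) \<le> G (Suc k) l + G k (Suc l)"
  shows "G 0 0 + G k l \<le> G k 0 + G 0 l"
proof (induction l)
  case (Suc l)
  have "G 0 (Suc l) - G 0 l \<ge> G k (Suc l) - G k l"
  proof (induction k)
    case (Suc k)
    then show ?case using assms[of k l] by linarith
  qed simp
  then show ?case using Suc by linarith
qed simp

lemma midpoint_convex_imp_submodular:
  fixes H :: "('i::finite \<Rightarrow> int) \<Rightarrow> real"
  assumes shift: "\<And>a c. a \<in> X \<Longrightarrow> (\<lambda>i. a i + c) \<in> X"
    and mid: "\<And>a b. a \<in> X \<Longrightarrow> b \<in> X \<Longrightarrow> (\<lambda>i. (a i + b i + 1) div 2) \<in> X \<and> (\<lambda>i. (a i + b i) div 2) \<in> X \<and>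
       H (\<lambda>i. (a i + b i + 1) div 2) + H (\<lambda>i. (a i + b i) div 2) \<le> H a + H b"
    and ab: "a \<in> X" "b \<in> X"
  shows "(\<lambda>i. max (a i) (b i)) \<in> X \<and> (\<lambda>i. min (a i) (b i)) \<in> X \<and>
    H (\<lambda>i. max (a i) (b i)) + H (\<lambda>i. min (a i) (b i)) \<le> H a + H b"
proof -
  have mx: "\<And>a b. a \<in> X \<Longrightarrow> b \<in> X \<Longrightarrow> (\<lambda>i. max (a i) (b i)) \<in> X"
    by (rule max_closed) (use mid in auto)
  have mn: "\<And>a b. a \<in> X \<Longrightarrow> b \<in> X \<Longrightarrow> (\<lambda>i. min (a i) (b i)) \<in> X"
    by (rule min_closed) (use mid in auto)
  define w where "w i = min (a i) (b i)" for i
  have w: "(\<lambda>i. w i + c) \<in> X" for c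
    unfolding w_def by (intro shift mn ab)
  \<comment> \<open>\<open>P k l\<close> rises from the minimum \<open>w\<close> by at most
    \<open>k\<close> towards \<open>a\<close> and at most \<open>l\<close> towards \<open>b\<close>.
    Each coordinate depends on only one of \<open>k\<close> and \<open>l\<close>, so the two
    opposite corners \<open>P (Suc k) l\<close> and \<open>P k (Suc l)\<close> of a unit square have
    the other two corners as their rounded midpoints.\<close>
  define P where "P k l = (\<lambda>i. max (min (a i) (w i + int k)) (min (b i) (w i + int l)))" for k l
  have P: "P k l \<in> X" for k l
    unfolding P_def by (intro mx mn ab w)
  have "H (P k l) + H (P (Suc k) (Suc l)) \<le> H (P (Suc k) l) + H (P k (Suc l))" for k l
  proof -
    have "(P (Suc k) l i + P k (Suc l) i + 1) div 2 = P (Suc k) (Suc l) i \<and>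
         (P (Suc k) l i + P k (Suc l) i) div 2 = P k l i" for i
    proof (cases "a i \<le> b i")
      case True
      then have "P k' l' i = min (b i) (a i + int l')" for k' l'
        by (simp add: P_def w_def)
      moreover have "min (b i) (a i + int (Suc l)) \<in>
          {min (b i) (a i + int l), min (b i) (a i + int l) + 1}" by auto
      ultimately show ?thesis by auto
    next
      case False
      then have "P k' l' i = min (a i) (b i + int k')" for k' l'
        by (simp add: P_def w_def)
      moreover have "min (a i) (b i + int (Suc k)) \<in>
          {min (a i) (b i + int k), min (a i) (b i + int k) + 1}" by auto
      ultimately show ?thesis by auto
    qed
    then show ?thesis
      using mid[OF P P, of "Suc k" l k "Suc l"] by (simp add: add.commute)
  qed
  note tel = square_telescope[of "\<lambda>k l. H (P k l)", OF this]
  define N where "N = (\<Sum>i\<in>UNIV. nat \<bar>a i - b i\<bar>)"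
  have "nat \<bar>a i - b i\<bar> \<le> N" for i
    unfolding N_def by (rule member_le_sum) auto
  then have N: "\<bar>a i - b i\<bar> \<le> int N" for i
    by (simp add: nat_le_iff)
  have "P 0 0 = (\<lambda>i. min (a i) (b i))" "P N 0 = a" "P 0 N = b" "P N N = (\<lambda>i. max (a i) (b i))"
    using N by (auto simp: P_def w_def fun_eq_iff) (smt (verit) N)+
  then show ?thesis using tel[of N N] mx[OF ab] mn[OF ab] by (simp add: add.commute)
qed

section \<open>Supporting hyperplanes of the epigraph\<close>

lemma abs_psum_le: "\<bar>psum x k\<bar> \<le> real CARD('n) * norm x" for x :: "real ^ ('n::{finite,linorder})"
proof (cases k)
  case (Some i)
  have "\<bar>psum x k\<bar> \<le> (\<Sum>j\<in>{..i}. \<bar>x $ j\<bar>)" using Some by (simp add: psum_def)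
  also have "\<dots> \<le> (\<Sum>j\<in>UNIV. \<bar>x $ j\<bar>)" by (rule sum_mono2) auto
  also have "\<dots> \<le> real CARD('n) * norm x"
    using sum_bounded_above[of UNIV "\<lambda>j. \<bar>x $ j\<bar>" "norm x"] component_le_norm_cart[of x] by simp
  finally show ?thesis .
qed simp

text \<open>\<open>D\<close> and \<open>F\<close> model the effective domain of \<open>f\<close> and
  its finite values, which keeps the convex geometry within the reals.\<close>

locale argmin_lsets =
  fixes D :: "(int ^ ('n::{finite,linorder})) set" and F :: "int ^ ('n::{finite,linorder}) \<Rightarrow> real"
  assumes lset_argmin: "\<And>p. lset {t \<in> D. \<forall>s\<in>D. F t - p \<bullet> real_vec t \<le> F s - p \<bullet> real_vec s}"
begin

definition minorant :: "(real, 'n) vec \<Rightarrow> real \<Rightarrow> bool" where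
  "minorant p \<alpha> \<longleftrightarrow> (\<forall>t\<in>D. p \<bullet> real_vec t + \<alpha> \<le> F t)"

definition tight :: "(real, 'n) vec \<Rightarrow> real \<Rightarrow> (int, 'n) vec set" where
  "tight p \<alpha> = {t \<in> D. F t = p \<bullet> real_vec t + \<alpha>}"

text \<open>The closure makes projections possible: for infinite \<open>D\<close> the convex hull
  need not be closed.\<close>

definition epi_hull :: "((real, 'n) vec \<times> real) set" where
  "epi_hull = closure (convex hull {(real_vec t, \<tau>) | t \<tau>. t \<in> D \<and> F t \<le> \<tau>})"

text \<open>If the minorant touches \<open>F\<close> at all, \<alpha> is the minimum of
  \<open>F\<close> minus the linear form, and the contact set is the full set of minimizers.\<close>

lemma lset_tight:
  assumes "minorant p \<alpha>"
  shows "lset (tight p \<alpha>)"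
proof (cases "tight p \<alpha> = {}")
  case False
  then obtain u where u: "u \<in> D" "F u = p \<bullet> real_vec u + \<alpha>" by (auto simp: tight_def)
  have "tight p \<alpha> = {t \<in> D. \<forall>s\<in>D. F t - p \<bullet> real_vec t \<le> F s - p \<bullet> real_vec s}"
  proof (intro equalityI subsetI)
    fix t assume "t \<in> tight p \<alpha>"
    then show "t \<in> {t \<in> D. \<forall>s\<in>D. F t - p \<bullet> real_vec t \<le> F s - p \<bullet> real_vec s}"
      using assms by (force simp: tight_def minorant_def)
  next
    fix t assume t: "t \<in> {t \<in> D. \<forall>s\<in>D. F t - p \<bullet> real_vec t \<le> F s - p \<bullet> real_vec s}"
    then have "F t - p \<bullet> real_vec t \<le> \<alpha>" using u by force
    moreover have "F t - p \<bullet> real_vec t \<ge> \<alpha>" using t assms by (force simp: minorant_def)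
    ultimately show "t \<in> tight p \<alpha>" using t by (simp add: tight_def)
  qed
  then show ?thesis using lset_argmin by simp
qed (simp add: lset_def)

lemma epi_hull_closed_convex: "closed epi_hull" "convex epi_hull"
  by (simp_all add: epi_hull_def convex_closure)

lemma epi_hull_gen: "t \<in> D \<Longrightarrow> (real_vec t, F t) \<in> epi_hull"
  unfolding epi_hull_def by (rule closure_subset[THEN subsetD], rule hull_inc) auto

lemma epi_hull_up:
  assumes "(x, \<tau>) \<in> epi_hull" "0 \<le> c"
  shows "(x, \<tau> + c) \<in> epi_hull"
proof -
  let ?g = "{(real_vec t, \<tau>) | t \<tau>. t \<in> D \<and> F t \<le> \<tau>}"
  have "(+) (0, c) ` ?g \<subseteq> ?g" using assms(2) by fastforce
  then have "(+) (0, c) ` (convex hull ?g) \<subseteq> convex hull ?g"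
    unfolding convex_hull_translation[symmetric] by (rule hull_mono)
  then have "(+) (0, c) ` epi_hull \<subseteq> epi_hull"
    unfolding epi_hull_def closure_translation[symmetric] by (rule closure_mono)
  then show ?thesis using assms(1) by (force simp: add.commute)
qed

text \<open>The inequality is affine in \<open>(x, \<tau>)\<close>, so it passes from the generators
  to their closed convex hull; \<open>0 \<le> B\<close> covers the generators above
  \<open>F s\<close>. Where the minorant touches the hull, the right side vanishes and a bound on
  \<open>L x\<close> remains.\<close>

lemma epi_hull_le:
  assumes "linear L" "0 \<le> B"
    and le: "\<And>s. s \<in> D \<Longrightarrow> L (real_vec s) + \<beta> \<le> B * (F s - p \<bullet> real_vec s - \<alpha>)"
    and x: "(x, \<tau>) \<in> epi_hull"
  shows "L x + \<beta> \<le> B * (\<tau> - p \<bullet> x - \<alpha>)"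
proof -
  let ?H = "{z. L (fst z) + \<beta> \<le> B * (snd z - p \<bullet> fst z - \<alpha>)}"
  have L: "bounded_linear L" using assms(1) linear_conv_bounded_linear by blast
  have "closed ?H"
    by (intro closed_Collect_le continuous_intros bounded_linear.continuous_on[OF L])
  moreover have "convex ?H"
  proof -
    define v where "v = (adjoint L 1 + B *\<^sub>R p, - B)"
    have "L y = y \<bullet> adjoint L 1" for y
      using adjoint_works[OF assms(1), of y 1] by (simp add: inner_commute)
    then have "?H = {z. v \<bullet> z \<le> - \<beta> - B * \<alpha>}"
      by (auto simp: v_def inner_prod_def inner_add_left algebra_simps inner_commute)
    then show ?thesis by (simp add: convex_halfspace_le)
  qed
  moreover have "{(real_vec t, \<tau>) | t \<tau>. t \<in> D \<and> F t \<le> \<tau>} \<subseteq> ?H"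
    using le assms(2) by clarsimp (smt (verit) mult_left_mono)
  ultimately have "epi_hull \<subseteq> ?H"
    unfolding epi_hull_def by (intro closure_minimal hull_minimal)
  then show ?thesis using x by auto
qed

text \<open>A supporting hyperplane of the closed convex hull of the epigraph, at a point close to \<open>z\<close>,
  is found by projecting a point that lies slightly below that hull.\<close>

lemma minorant_near:
  assumes m0: "minorant p0 \<alpha>0" and z: "(z, \<tau>0) \<in> epi_hull" and "\<eta> > 0"
  obtains p \<alpha> x where "minorant p \<alpha>" "(x, p \<bullet> x + \<alpha>) \<in> epi_hull" "norm (z - x) \<le> \<eta>"
proof -
  define T where "T = {\<tau>. (z, \<tau>) \<in> epi_hull}"
  have "p0 \<bullet> z + \<alpha>0 \<le> \<tau>" if "(z, \<tau>) \<in> epi_hull" for \<tau>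
    using epi_hull_le[of "\<lambda>_. 0" 1 0 p0 \<alpha>0, OF _ _ _ that] m0
    by (simp add: linear_zero minorant_def algebra_simps)
  then have bdd: "bdd_below T" unfolding T_def by (intro bdd_belowI) auto
  have "closed ((\<lambda>\<tau>. (z, \<tau>)) -` epi_hull)"
    by (intro closed_vimage epi_hull_closed_convex continuous_intros)
  then have clT: "closed T" by (simp add: T_def vimage_def)
  define m where "m = Inf T"
  have m: "(z, m) \<in> epi_hull"
    using closed_contains_Inf[OF _ bdd clT] z by (auto simp: T_def m_def)
  have mle: "m \<le> \<tau>" if "(z, \<tau>) \<in> epi_hull" for \<tau>
    using cInf_lower[OF _ bdd] that by (simp add: m_def T_def)
  \<comment> \<open>\<open>y\<close> lies \<eta> below the lowest point \<open>(z, m)\<close> of the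
    hull over \<open>z\<close>, hence outside the hull but within distance \<eta> of it.\<close>
  define y where "y = (z, m - \<eta>)"
  define c where "c = closest_point epi_hull y"
  define x where "x = fst c"
  define h where "h = snd c - (m - \<eta>)"
  define q where "q = z - x"
  have ne: "epi_hull \<noteq> {}" using z by auto
  have c: "c \<in> epi_hull" unfolding c_def by (rule closest_point_in_set[OF epi_hull_closed_convex(1) ne])
  have dot: "q \<bullet> (x' - x) \<le> h * (\<tau> - snd c)" if "(x', \<tau>) \<in> epi_hull" for x' \<tau>
  proof -
    have "(y - c) \<bullet> ((x', \<tau>) - c) \<le> 0"
      unfolding c_def by (rule closest_point_dot[OF epi_hull_closed_convex(2,1) that])
    then show ?thesis by (simp add: y_def q_def h_def x_def inner_prod_def algebra_simps)
  qed
  have "(x, snd c + 1) \<in> epi_hull" using epi_hull_up[of x "snd c" 1] c by (simp add: x_def)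
  from dot[OF this] have "h \<ge> 0" by simp
  \<comment> \<open>The hyperplane is not vertical: with \<open>h = 0\<close>, testing against
    \<open>(z, m)\<close> gives \<open>q = 0\<close>, so \<open>y\<close> itself would lie in the
    hull, below the minimum \<open>m\<close>.\<close>
  moreover have "h \<noteq> 0"
  proof
    assume "h = 0"
    with dot[OF m] have "q \<bullet> q \<le> 0" by (simp add: q_def)
    then have "q = 0" by (metis inner_ge_zero inner_eq_zero_iff order_antisym)
    then have "(z, m - \<eta>) \<in> epi_hull" using c \<open>h = 0\<close> by (cases c) (simp add: q_def x_def h_def)
    from mle[OF this] show False using \<open>\<eta> > 0\<close> by simp
  qed
  ultimately have h: "h > 0" by simp
  define p where "p = (1 / h) *\<^sub>R q"
  define \<alpha> where "\<alpha> = snd c - p \<bullet> x"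
  have "p \<bullet> x' + \<alpha> \<le> \<tau>" if "(x', \<tau>) \<in> epi_hull" for x' \<tau>
  proof -
    have "p \<bullet> (x' - x) \<le> \<tau> - snd c"
      using dot[OF that] h by (simp add: p_def field_simps)
    then show ?thesis by (simp add: \<alpha>_def inner_diff_right)
  qed
  then have "minorant p \<alpha>" by (auto simp: minorant_def intro: epi_hull_gen)
  moreover have "(x, p \<bullet> x + \<alpha>) \<in> epi_hull" using c by (simp add: \<alpha>_def x_def)
  moreover have "norm (z - x) \<le> \<eta>"
  proof -
    have "dist y c \<le> dist y (z, m)"
      unfolding c_def by (rule closest_point_le[OF epi_hull_closed_convex(1) m])
    also have "\<dots> = \<eta>" using \<open>\<eta> > 0\<close> by (simp add: y_def dist_Pair_Pair dist_norm)
    finally show ?thesis using dist_fst_le[of y c] by (simp add: y_def x_def dist_norm)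
  qed
  ultimately show ?thesis by (rule that)
qed

text \<open>Take a minorant touching the hull at a point \<open>x\<close> close to the midpoint
  \<open>z\<close>. By \<open>touch\<close> the integer bounds on partial sums over the contact set
  hold at \<open>x\<close>, which forces both roundings into the contact set. There \<open>F\<close>
  is affine, and the roundings have the same sum as the given points. The assumption
  \<open>touch\<close> is where finite and infinite \<open>D\<close> need different
  arguments.\<close>

lemma midpoint_convex:
  assumes m0: "minorant p0 \<alpha>0"
    and touch: "\<And>p \<alpha> x i j c. minorant p \<alpha> \<Longrightarrow> (x, p \<bullet> x + \<alpha>) \<in> epi_hull \<Longrightarrow>
      (\<And>s. s \<in> tight p \<alpha> \<Longrightarrow> psum s j - psum s i \<le> c) \<Longrightarrow> psum x j - psum x i \<le> real_of_int c"
    and a: "diffs a \<in> D" and b: "diffs b \<in> D"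
  shows "diffs (\<lambda>i. (a i + b i + 1) div 2) \<in> D \<and> diffs (\<lambda>i. (a i + b i) div 2) \<in> D \<and>
    F (diffs (\<lambda>i. (a i + b i + 1) div 2)) + F (diffs (\<lambda>i. (a i + b i) div 2)) \<le> F (diffs a) + F (diffs b)"
proof -
  define z where "z = (1 / 2) *\<^sub>R real_vec (diffs a) + (1 / 2) *\<^sub>R real_vec (diffs b)"
  \<comment> \<open>Partial sums then change by at most 1/8 between \<open>z\<close> and
    \<open>x\<close>, and their differences by at most 1/4.\<close>
  define \<eta> where "\<eta> = 1 / (8 * real CARD('n))"
  have "(1 / 2) *\<^sub>R (real_vec (diffs a), F (diffs a)) + (1 / 2) *\<^sub>R (real_vec (diffs b), F (diffs b)) \<in> epi_hull"
    by (intro convexD[OF epi_hull_closed_convex(2)] epi_hull_gen a b) auto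
  then have "(z, (1 / 2) * F (diffs a) + (1 / 2) * F (diffs b)) \<in> epi_hull"
    by (simp add: z_def)
  moreover have "\<eta> > 0" by (simp add: \<eta>_def)
  ultimately obtain p \<alpha> x where p: "minorant p \<alpha>" "(x, p \<bullet> x + \<alpha>) \<in> epi_hull" "norm (z - x) \<le> \<eta>"
    using minorant_near[OF m0] by blast
  have zx: "\<bar>psum z k - psum x k\<bar> \<le> 1 / 8" for k
  proof -
    have "\<bar>psum (z - x) k\<bar> \<le> real CARD('n) * \<eta>"
      by (rule order_trans[OF abs_psum_le]) (use p(3) in simp)
    then show ?thesis by (simp add: psum_diff \<eta>_def)
  qed
  have z: "psum z k = (real_of_int (a k) + real_of_int (b k)) / 2 -
      (real_of_int (a None) + real_of_int (b None)) / 2" for k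
    by (simp add: z_def psum_add psum_scaleR psum_real_vec psum_diffs field_simps)
  \<comment> \<open>Rounding costs at most 1/2 and the move from \<open>z\<close> to
    \<open>x\<close> at most 1/4; a violated integer bound would be off by 1.\<close>
  have mem: "diffs r \<in> tight p \<alpha>"
    if r: "\<And>i j. real_of_int (r j) - real_of_int (r i) - 1 / 2 \<le> psum z j - psum z i" for r
  proof (rule lset_memI[OF lset_tight[OF p(1)]])
    fix i j
    show "\<exists>s\<in>tight p \<alpha>. psum (diffs r) j - psum (diffs r) i \<le> psum s j - psum s i"
    proof (rule ccontr)
      assume "\<not> ?thesis"
      then have "psum s j - psum s i \<le> r j - r i - 1" if "s \<in> tight p \<alpha>" for s
        using that by (force simp: psum_diffs)
      from touch[OF p(1,2) this] have "psum x j - psum x i \<le> real_of_int (r j - r i - 1)" by simp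
      with r[of j i] zx[of i] zx[of j] show False by simp
    qed
  qed
  define r where "r = (\<lambda>i. (a i + b i + 1) div 2)"
  define w where "w = (\<lambda>i. (a i + b i) div 2)"
  have ab: "r i = w i \<and> a i + b i = 2 * w i \<or> r i = w i + 1 \<and> a i + b i = 2 * w i + 1" for i
    unfolding r_def w_def by presburger
  have ab': "real_of_int (a i) + real_of_int (b i) = real_of_int (r i) + real_of_int (w i)" for i
    using ab[of i] by linarith
  have rw: "real_of_int (r i) = real_of_int (w i) \<or> real_of_int (r i) = real_of_int (w i) + 1" for i
    using ab[of i] by auto
  have "real_of_int (r j) - real_of_int (r i) - 1 / 2 \<le> psum z j - psum z i \<and>
      real_of_int (w j) - real_of_int (w i) - 1 / 2 \<le> psum z j - psum z i" for i j
    using rw[of i] rw[of j] unfolding z ab' by (auto simp: field_simps)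
  then have "diffs r \<in> tight p \<alpha>" "diffs w \<in> tight p \<alpha>"
    by (auto intro: mem)
  then have rw: "diffs r \<in> D" "diffs w \<in> D" "F (diffs r) = p \<bullet> real_vec (diffs r) + \<alpha>"
     "F (diffs w) = p \<bullet> real_vec (diffs w) + \<alpha>" by (auto simp: tight_def)
  have "real_vec (diffs r) + real_vec (diffs w) = real_vec (diffs a) + real_vec (diffs b)"
    by (simp add: diffs_real_vec diffs_add[symmetric] ab')
  then have "F (diffs r) + F (diffs w) = p \<bullet> real_vec (diffs a) + \<alpha> + (p \<bullet> real_vec (diffs b) + \<alpha>)"
    unfolding rw(3,4) by (metis (no_types, opaque_lifting) add.assoc add.commute inner_add_right)
  also have "\<dots> \<le> F (diffs a) + F (diffs b)"
    using p(1) a b by (intro add_mono) (auto simp: minorant_def)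
  finally show ?thesis using rw unfolding r_def w_def by simp
qed

lemma submodular_if_touch:
  assumes m0: "minorant p0 \<alpha>0"
    and touch: "\<And>p \<alpha> x i j c. minorant p \<alpha> \<Longrightarrow> (x, p \<bullet> x + \<alpha>) \<in> epi_hull \<Longrightarrow>
      (\<And>s. s \<in> tight p \<alpha> \<Longrightarrow> psum s j - psum s i \<le> c) \<Longrightarrow> psum x j - psum x i \<le> real_of_int c"
    and a: "diffs a \<in> D" and b: "diffs b \<in> D"
  shows "diffs (\<lambda>i. max (a i) (b i)) \<in> D \<and> diffs (\<lambda>i. min (a i) (b i)) \<in> D \<and>
    F (diffs (\<lambda>i. max (a i) (b i))) + F (diffs (\<lambda>i. min (a i) (b i))) \<le> F (diffs a) + F (diffs b)"
  using midpoint_convex_imp_submodular[of "{a. diffs a \<in> D}" "\<lambda>a. F (diffs a)" a b]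
    midpoint_convex[OF m0 touch] a b by (simp add: diffs_shift)

text \<open>Off the contact set the gap \<open>h\<close> is bounded away from 0, so a large multiple
  of it dominates the violation \<open>w\<close>; on the contact set \<open>w\<close> is
  nonpositive. The bound extends to the hull by \<open>epi_hull_le\<close>.\<close>

lemma touch_finite:
  assumes "finite D" and p: "minorant p \<alpha>" and x: "(x, p \<bullet> x + \<alpha>) \<in> epi_hull"
    and le: "\<And>s. s \<in> tight p \<alpha> \<Longrightarrow> psum s j - psum s i \<le> c"
  shows "psum x j - psum x i \<le> real_of_int c"
proof -
  define h where "h s = F s - p \<bullet> real_vec s - \<alpha>" for s
  define w where "w s = psum (real_vec s) j - psum (real_vec s) i - real_of_int c" for s
  have h: "h s \<ge> 0" if "s \<in> D" for s using p that by (force simp: minorant_def h_def)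
  have "\<exists>B\<ge>0. \<forall>s\<in>D. w s \<le> B * h s"
  \<comment> \<open>The sum dominates every single quotient; contact points contribute 0 because
    division by zero yields 0.\<close>
  proof (intro exI[of _ "\<Sum>s\<in>D. \<bar>w s\<bar> / h s"] conjI ballI sum_nonneg)
    fix s assume s: "s \<in> D"
    show "0 \<le> \<bar>w s\<bar> / h s" using h[OF s] by simp
    show "w s \<le> (\<Sum>s\<in>D. \<bar>w s\<bar> / h s) * h s"
    proof (cases "h s = 0")
      case True
      then have "s \<in> tight p \<alpha>" using s by (simp add: tight_def h_def)
      from le[OF this] have "w s \<le> 0" by (simp add: w_def psum_real_vec)
      then show ?thesis using True by simp
    next
      case False
      then have "w s \<le> \<bar>w s\<bar> / h s * h s" by simp
      also have "\<dots> \<le> (\<Sum>s\<in>D. \<bar>w s\<bar> / h s) * h s"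
        by (intro mult_right_mono member_le_sum s assms) (use h s in auto)
      finally show ?thesis .
    qed
  qed
  then obtain B where B: "B \<ge> 0" "\<And>s. s \<in> D \<Longrightarrow> w s \<le> B * h s" by blast
  have "linear (\<lambda>x. psum x j - psum x i :: real)"
    by (intro linear_compose_sub bounded_linear.linear[OF bounded_linear_psum])
  from epi_hull_le[OF this B(1) _ x, of "- real_of_int c" p \<alpha>] show ?thesis
    using B(2) by (simp add: w_def h_def)
qed

end

section \<open>Recession directions of convex extensions\<close>

lemma frequently_closed_limit:
  assumes "closed S" "(f \<longlongrightarrow> l) net" "\<exists>\<^sub>F x in net. f x \<in> S"
  shows "l \<in> S"
proof (rule ccontr)
  assume "l \<notin> S"
  then have "\<forall>\<^sub>F x in net. f x \<in> - S"
    using topological_tendstoD[OF assms(2), of "- S"] assms(1) by auto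
  then show False using assms(3) by (simp add: frequently_def)
qed

text \<open>The missing weight \<open>1 - sum c I\<close> is put on \<open>u\<close>, represented by
  the extra index \<open>None\<close>.\<close>

lemma convex_sum_le_one:
  assumes "finite I" "convex C" "\<And>i. i \<in> I \<Longrightarrow> 0 \<le> c i" "sum c I \<le> 1" "u \<in> C" "\<And>i. i \<in> I \<Longrightarrow> y i \<in> C"
  shows "u + (\<Sum>i\<in>I. c i *\<^sub>R (y i - u)) \<in> C"
proof -
  have "(\<Sum>k\<in>insert None (Some ` I). (case k of None \<Rightarrow> 1 - sum c I | Some i \<Rightarrow> c i) *\<^sub>R
      (case k of None \<Rightarrow> u | Some i \<Rightarrow> y i)) \<in> C"
    by (rule convex_sum) (use assms in \<open>auto simp: sum.reindex\<close>)
  then show ?thesis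
    using assms(1)
    by (simp add: sum.reindex scaleR_diff_right scaleR_diff_left sum_subtractf scaleR_sum_left algebra_simps)
qed

text \<open>Approximating \<open>N * \<theta>\<close> instead of \<theta> makes the common
  denominator a multiple of \<open>N\<close>, hence large.\<close>

lemma Dirichlet_approx_large:
  fixes \<theta> :: "nat \<Rightarrow> real" and N n :: nat
  assumes "N > 0"
  obtains q p where "int N \<le> q" "\<And>i. i < n \<Longrightarrow> \<bar>of_int q * \<theta> i - of_int (p i)\<bar> < 1 / N"
proof -
  obtain q p where q: "0 < q" "\<And>i. i < n \<Longrightarrow> \<bar>of_int q * (real N * \<theta> i) - of_int (p i)\<bar> < 1 / N"
    using Dirichlet_approx_simult[OF assms, of n "\<lambda>i. real N * \<theta> i"] by blast
  show thesis
    by (rule that[of "q * int N" p]) (use q assms in \<open>auto simp: mult.assoc\<close>)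
qed

lemma finite_lattice_bounded: "finite {t :: int ^ 'n. norm (real_vec t) \<le> R}"
proof -
  have "vec_nth ` {t :: int ^ 'n. norm (real_vec t) \<le> R} \<subseteq> UNIV \<rightarrow>\<^sub>E {- \<lceil>R\<rceil>..\<lceil>R\<rceil>}"
  proof (intro image_subsetI PiE_I)
    fix t :: "int ^ 'n" and i
    assume "t \<in> {t. norm (real_vec t) \<le> R}"
    then have "\<bar>real_of_int (t $ i)\<bar> \<le> R"
      using component_le_norm_cart[of "real_vec t" i] by (simp add: real_vec_def)
    then show "t $ i \<in> {- \<lceil>R\<rceil>..\<lceil>R\<rceil>}" by simp linarith
  qed simp
  moreover have "finite (UNIV \<rightarrow>\<^sub>E {- \<lceil>R\<rceil>..\<lceil>R\<rceil>} :: ('n \<Rightarrow> int) set)"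
    by (intro finite_PiE) auto
  ultimately show ?thesis
    by (metis finite_subset finite_imageD inj_onI vec_nth_inject)
qed

lemma finite_lattice_of_bounded:
  fixes D :: "(int ^ 'n) set"
  assumes "bounded (real_vec ` D)"
  shows "finite D"
proof -
  obtain R where "\<forall>t\<in>D. norm (real_vec t) \<le> R" using assms by (auto simp: bounded_iff)
  then show ?thesis by (intro finite_subset[OF _ finite_lattice_bounded[of R]]) auto
qed

text \<open>\<open>G\<close> is the epigraph of the convex extension, restricted to the convex hull of \<open>D\<close>.\<close>

locale extensible_lsets = argmin_lsets D F
  for D :: "(int ^ ('n::{finite,linorder})) set" and F :: "int ^ ('n::{finite,linorder}) \<Rightarrow> real" +
  fixes G :: "((real, 'n) vec \<times> real) set"
  assumes G: "convex G" "closed G"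
    and G_gen: "\<And>t. t \<in> D \<Longrightarrow> (real_vec t, F t) \<in> G"
    and G_int: "\<And>t \<tau>. (real_vec t, \<tau>) \<in> G \<Longrightarrow> t \<in> D \<and> F t \<le> \<tau>"
    and G_dom: "\<And>x \<tau>. (x, \<tau>) \<in> G \<Longrightarrow> x \<in> convex hull (real_vec ` D)"
    and G_loc: "\<And>u. u \<in> D \<Longrightarrow> \<exists>M. finite M \<and>
      (\<forall>(q, \<beta>)\<in>M. \<forall>(x, \<tau>)\<in>G. x \<in> cbox (real_vec u - One) (real_vec u + One) \<longrightarrow> q \<bullet> x + \<beta> \<le> \<tau>) \<and>
      (\<forall>(x, \<tau>)\<in>G. x \<in> cbox (real_vec u - One) (real_vec u + One) \<longrightarrow> (\<exists>(q, \<beta>)\<in>M. (x, q \<bullet> x + \<beta>) \<in> G))"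
begin

text \<open>\<open>(d, p \<bullet> d)\<close> is a recession direction of \<open>G\<close>; in other
  words, the extension of \<open>f[-p]\<close> does not increase along \<open>d\<close>.\<close>

definition recdir :: "(real, 'n) vec \<Rightarrow> (real, 'n) vec \<Rightarrow> bool" where
  "recdir p d \<longleftrightarrow> (\<forall>x \<tau> c. (x, \<tau>) \<in> G \<longrightarrow> 0 \<le> c \<longrightarrow> (x + c *\<^sub>R d, \<tau> + c * (p \<bullet> d)) \<in> G)"

lemma recdirD: "recdir p d \<Longrightarrow> (x, \<tau>) \<in> G \<Longrightarrow> 0 \<le> c \<Longrightarrow> (x + c *\<^sub>R d, \<tau> + c * (p \<bullet> d)) \<in> G"
  by (simp add: recdir_def)

lemma recdir_cong: "p \<bullet> d = q \<bullet> d \<Longrightarrow> recdir p d = recdir q d"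
  by (simp add: recdir_def)

lemma recdir_scale: "recdir p d \<Longrightarrow> 0 \<le> c \<Longrightarrow> recdir p (c *\<^sub>R d)"
  unfolding recdir_def by (metis inner_scaleR_right mult.assoc scaleR_scaleR mult_nonneg_nonneg)

lemma recdir_add:
  assumes "recdir p d" "recdir p e" shows "recdir p (d + e)"
  unfolding recdir_def
proof (intro allI impI)
  fix x \<tau> and c :: real assume "(x, \<tau>) \<in> G" "0 \<le> c"
  then have "(x + c *\<^sub>R d + c *\<^sub>R e, \<tau> + c * (p \<bullet> d) + c * (p \<bullet> e)) \<in> G"
    by (intro recdirD assms)
  then show "(x + c *\<^sub>R (d + e), \<tau> + c * (p \<bullet> (d + e))) \<in> G"
    by (simp add: algebra_simps inner_add_right)
qed

lemma closed_recdir: "closed {d. recdir p d}"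
proof -
  have "{d. recdir p d} = (\<Inter>z\<in>G. \<Inter>c\<in>{0..}. (\<lambda>d. (fst z + c *\<^sub>R d, snd z + c * (p \<bullet> d))) -` G)"
    by (force simp: recdir_def)
  also have "closed \<dots>"
    by (intro closed_INT ballI closed_vimage G(2) continuous_intros)
  finally show ?thesis .
qed

text \<open>Moving from \<open>(x, \<tau>)\<close> towards the generator of \<open>t k\<close> with
  weight \<open>c / r k\<close> stays in \<open>G\<close> by convexity, and in the limit this is a
  step of \<open>c\<close> times \<open>d\<close>. The last assumption makes the slope of the values
  equal to \<open>p \<bullet> d\<close>.\<close>

lemma recdir_limit:
  assumes t: "\<And>k. t k \<in> D" and r: "filterlim r at_top sequentially"
    and d: "(\<lambda>k. (1 / r k) *\<^sub>R real_vec (t k)) \<longlonglongrightarrow> d"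
    and f: "(\<lambda>k. (F (t k) - p \<bullet> real_vec (t k) - \<alpha>) / r k) \<longlonglongrightarrow> 0"
  shows "recdir p d"
  unfolding recdir_def
proof (intro allI impI)
  fix x \<tau> and c :: real assume x: "(x, \<tau>) \<in> G" and c: "0 \<le> c"
  have inv: "(\<lambda>k. 1 / r k) \<longlonglongrightarrow> 0"
    using tendsto_inverse_0_at_top[OF r] by (simp add: inverse_eq_divide)
  have "(\<lambda>k. (F (t k) - p \<bullet> real_vec (t k) - \<alpha>) / r k + p \<bullet> ((1 / r k) *\<^sub>R real_vec (t k)) + \<alpha> * (1 / r k))
      \<longlonglongrightarrow> 0 + p \<bullet> d + \<alpha> * 0"
    by (intro tendsto_intros f d inv)
  then have F: "(\<lambda>k. F (t k) * (1 / r k)) \<longlonglongrightarrow> p \<bullet> d"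
    by (simp add: add_divide_distrib[symmetric])
  have "(\<lambda>k. ((1 - c * (1 / r k)) *\<^sub>R x + c *\<^sub>R ((1 / r k) *\<^sub>R real_vec (t k)),
       (1 - c * (1 / r k)) * \<tau> + c * (F (t k) * (1 / r k)))) \<longlonglongrightarrow>
     ((1 - c * 0) *\<^sub>R x + c *\<^sub>R d, (1 - c * 0) * \<tau> + c * (p \<bullet> d))"
    by (intro tendsto_intros inv d F)
  moreover have "\<forall>\<^sub>F k in sequentially. ((1 - c * (1 / r k)) *\<^sub>R x + c *\<^sub>R ((1 / r k) *\<^sub>R real_vec (t k)),
       (1 - c * (1 / r k)) * \<tau> + c * (F (t k) * (1 / r k))) \<in> G"
    using filterlim_at_top_dense[THEN iffD1, OF r, rule_format, of 0]
      filterlim_at_top[THEN iffD1, OF r, rule_format, of c]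
  proof eventually_elim
    case (elim k)
    then have "(1 - c / r k) *\<^sub>R (x, \<tau>) + (c / r k) *\<^sub>R (real_vec (t k), F (t k)) \<in> G"
      using c by (intro convexD[OF G(1)] x G_gen t) auto
    then show ?case by simp
  qed
  ultimately have "((1 - c * 0) *\<^sub>R x + c *\<^sub>R d, (1 - c * 0) * \<tau> + c * (p \<bullet> d)) \<in> G"
    by (rule Lim_in_closed_set[OF G(2), rotated 2, OF _ ]) simp_all
  then show "(x + c *\<^sub>R d, \<tau> + c * (p \<bullet> d)) \<in> G" by simp
qed

text \<open>The segment from \<open>u\<close> to \<open>x\<close> starts inside the box, and the
  affine function agrees with \<open>F\<close> at \<open>u\<close>; by convexity a violation at
  \<open>x\<close> would also occur close to \<open>u\<close>.\<close>

lemma local_minorant_global: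
  assumes u: "u \<in> D" and eq: "F u = q \<bullet> real_vec u + \<beta>"
    and loc: "\<And>x \<tau>. (x, \<tau>) \<in> G \<Longrightarrow> x \<in> cbox (real_vec u - One) (real_vec u + One) \<Longrightarrow> q \<bullet> x + \<beta> \<le> \<tau>"
    and x: "(x, \<tau>) \<in> G"
  shows "q \<bullet> x + \<beta> \<le> \<tau>"
proof -
  let ?u = "real_vec u"
  have "(\<lambda>\<theta>. (1 - \<theta>) *\<^sub>R ?u + \<theta> *\<^sub>R x) \<midarrow>0\<rightarrow> (1 - 0) *\<^sub>R ?u + 0 *\<^sub>R x"
    by (intro tendsto_intros)
  moreover have "(1 - 0) *\<^sub>R ?u + 0 *\<^sub>R x \<in> box (?u - One) (?u + One)"
    by (simp add: mem_box inner_diff_left inner_add_left)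
  ultimately have "\<forall>\<^sub>F \<theta> in at 0. (1 - \<theta>) *\<^sub>R ?u + \<theta> *\<^sub>R x \<in> box (?u - One) (?u + One)"
    by (rule topological_tendstoD[OF _ open_box])
  then have "\<forall>\<^sub>F \<theta> in at_right 0. (1 - \<theta>) *\<^sub>R ?u + \<theta> *\<^sub>R x \<in> box (?u - One) (?u + One)"
    by (simp add: eventually_at_split)
  moreover have "\<forall>\<^sub>F \<theta> in at_right (0::real). 0 < \<theta>" "\<forall>\<^sub>F \<theta> in at_right (0::real). \<theta> < 1"
    by (auto simp: eventually_at_right_field intro: exI[of _ 1])
  ultimately have "\<forall>\<^sub>F \<theta> in at_right 0. (1 - \<theta>) *\<^sub>R ?u + \<theta> *\<^sub>R x \<in> box (?u - One) (?u + One) \<and> 0 < \<theta> \<and> \<theta> < 1"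
    by eventually_elim auto
  then obtain \<theta> where \<theta>: "(1 - \<theta>) *\<^sub>R ?u + \<theta> *\<^sub>R x \<in> box (?u - One) (?u + One)" "0 < \<theta>" "\<theta> < 1"
    using eventually_happens'[OF trivial_limit_at_right_real] by blast
  have "(1 - \<theta>) *\<^sub>R (?u, F u) + \<theta> *\<^sub>R (x, \<tau>) \<in> G"
    by (intro convexD[OF G(1)] x G_gen u) (use \<theta> in auto)
  then have "q \<bullet> ((1 - \<theta>) *\<^sub>R ?u + \<theta> *\<^sub>R x) + \<beta> \<le> (1 - \<theta>) * F u + \<theta> * \<tau>"
    using loc \<theta>(1) box_subset_cbox[of "?u - One" "?u + One"] by auto
  then have "\<theta> * (q \<bullet> x + \<beta>) \<le> \<theta> * \<tau>"
    by (simp add: eq algebra_simps inner_add_right)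
  then show ?thesis using \<theta> by simp
qed

lemma G_over_hull: "x \<in> convex hull (real_vec ` D) \<Longrightarrow> \<exists>\<tau>. (x, \<tau>) \<in> G"
proof -
  assume x: "x \<in> convex hull (real_vec ` D)"
  have "convex (fst ` G)" by (intro convex_linear_image linear_fst G)
  moreover have "real_vec ` D \<subseteq> fst ` G" using G_gen by force
  ultimately have "convex hull (real_vec ` D) \<subseteq> fst ` G" by (rule hull_minimal[rotated])
  then show ?thesis using x by force
qed

text \<open>One of the finitely many affine pieces around \<open>u\<close> is active at
  \<open>u\<close>, and as a local minorant it is a global one.\<close>

lemma ex_subgradient:
  assumes "u \<in> D"
  obtains q \<beta> where "\<And>x \<tau>. (x, \<tau>) \<in> G \<Longrightarrow> q \<bullet> x + \<beta> \<le> \<tau>" "u \<in> tight q \<beta>" "minorant q \<beta>"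
proof -
  let ?u = "real_vec u"
  obtain M where M: "\<forall>(q, \<beta>)\<in>M. \<forall>(x, \<tau>)\<in>G. x \<in> cbox (?u - One) (?u + One) \<longrightarrow> q \<bullet> x + \<beta> \<le> \<tau>"
     "\<forall>(x, \<tau>)\<in>G. x \<in> cbox (?u - One) (?u + One) \<longrightarrow> (\<exists>(q, \<beta>)\<in>M. (x, q \<bullet> x + \<beta>) \<in> G)"
    using G_loc[OF assms] by blast
  have u: "?u \<in> cbox (?u - One) (?u + One)"
    by (simp add: mem_box inner_diff_left inner_add_left)
  obtain q \<beta> where q: "(q, \<beta>) \<in> M" "(?u, q \<bullet> ?u + \<beta>) \<in> G"
    using M(2) G_gen[OF assms] u by blast
  have "F u = q \<bullet> ?u + \<beta>"
    using G_int[OF q(2)] M(1) q(1) G_gen[OF assms] u by fastforce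
  moreover from this have "q \<bullet> x + \<beta> \<le> \<tau>" if "(x, \<tau>) \<in> G" for x \<tau>
    by (rule local_minorant_global[OF assms]) (use M(1) q(1) that in auto)
  ultimately show ?thesis
    using that[of q \<beta>] assms G_gen by (auto simp: tight_def minorant_def)
qed

end

lemma frequently_eventuallyE:
  assumes "\<exists>\<^sub>F x in F. P x" "\<forall>\<^sub>F x in F. Q x"
  obtains x where "P x" "Q x"
proof -
  obtain x where "Q x \<and> P x"
    using frequently_ex[OF frequently_eventually_conj[OF assms]] by (rule exE)
  then show thesis by (intro that[of x]) auto
qed

context extensible_lsets
begin

text \<open>If \<open>e\<close> is irrational, the ray from \<open>u\<close> in direction \<open>e\<close> may miss all other lattice points. The
  lattice points \<open>t k\<close> lie close to the ray, and stepping back from them along \<open>e\<close> leads to points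
  near \<open>u\<close> that stay inside the hull.\<close>

lemma lattice_near_ray:
  assumes u: "u \<in> D" and e: "recdir p e"
  obtains N :: "nat \<Rightarrow> int" and t :: "nat \<Rightarrow> (int, 'n) vec" and y :: "nat \<Rightarrow> (real, 'n) vec"
  where "\<And>k. int k < N k" "y \<longlonglongrightarrow> 0"
    "\<And>k. real_vec (t k) = real_vec u + real_of_int (N k) *\<^sub>R e + y k"
    "\<And>\<epsilon>. 0 < \<epsilon> \<Longrightarrow> \<epsilon> < 1 \<Longrightarrow>
       \<forall>\<^sub>F k in sequentially. real_vec u + \<epsilon> *\<^sub>R e + y k \<in> convex hull (real_vec ` D)"
proof -
  let ?u = "real_vec u"
  have "(?u + 1 *\<^sub>R e, F u + 1 * (p \<bullet> e)) \<in> G"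
    by (intro recdirD[OF e] G_gen u) simp
  then have "?u + e \<in> convex hull (real_vec ` D)" using G_dom by simp
  then obtain K c z where c: "\<And>i. i \<in> {1..K::nat} \<Longrightarrow> 0 \<le> (c i :: real)" "\<And>i. i \<in> {1..K} \<Longrightarrow> z i \<in> real_vec ` D"
     "sum c {1..K} = 1" "(\<Sum>i = 1..K. c i *\<^sub>R z i) = ?u + e"
    unfolding convex_hull_indexed by blast
  have "\<exists>s. \<forall>i\<in>{1..K}. s i \<in> D \<and> z i = real_vec (s i)"
    by (rule bchoice, intro ballI) (use c(2) in blast)
  then obtain s where s: "\<And>i. i \<in> {1..K} \<Longrightarrow> s i \<in> D" "\<And>i. i \<in> {1..K} \<Longrightarrow> z i = real_vec (s i)"
    by blast
  have e_eq: "e = (\<Sum>i = 1..K. c i *\<^sub>R (real_vec (s i) - ?u))"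
  proof -
    have "(\<Sum>i = 1..K. c i *\<^sub>R (real_vec (s i) - ?u)) = (\<Sum>i = 1..K. c i *\<^sub>R z i) - (\<Sum>i = 1..K. c i) *\<^sub>R ?u"
      by (simp add: scaleR_diff_right sum_subtractf scaleR_sum_left s(2))
    then show ?thesis using c(3,4) by simp
  qed
  \<comment> \<open>Simultaneous approximation makes all \<open>N k * c i\<close> nearly integral,
    so rounding these weights yields a lattice point close to the ray.\<close>
  have "\<exists>q m. int (Suc k) \<le> q \<and> (\<forall>i<Suc K. \<bar>of_int q * c i - of_int (m i)\<bar> < 1 / real (Suc k))" for k
    by (rule Dirichlet_approx_large[of "Suc k" "Suc K" c]) auto
  then obtain N m where N: "\<And>k. int (Suc k) \<le> N k"
    and m: "\<And>k i. i < Suc K \<Longrightarrow> \<bar>of_int (N k) * c i - of_int (m k i)\<bar> < 1 / real (Suc k)"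
    by metis
  \<comment> \<open>Zero weights keep the error exactly 0; otherwise the coefficients
    \<open>\<epsilon> * c i + \<delta> k i\<close> below could become negative.\<close>
  define n where "n k i = (if c i = 0 then 0 else m k i)" for k i
  define \<delta> where "\<delta> k i = real_of_int (n k i) - of_int (N k) * c i" for k i
  have \<delta>: "\<bar>\<delta> k i\<bar> \<le> 1 / real (Suc k)" if "i \<in> {1..K}" for k i
    using m[of i k] that by (simp add: \<delta>_def n_def abs_minus_commute less_imp_le)
  have \<delta>0: "(\<lambda>k. \<delta> k i) \<longlonglongrightarrow> 0" if "i \<in> {1..K}" for i
    by (rule Lim_null_comparison[OF _ LIMSEQ_Suc[OF lim_1_over_n]]) (use \<delta>[OF that] in simp)
  define y where "y k = (\<Sum>i = 1..K. \<delta> k i *\<^sub>R (real_vec (s i) - ?u))" for k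
  have \<delta>_eq: "(\<Sum>i = 1..K. (r * c i + \<delta> k i) *\<^sub>R (real_vec (s i) - ?u)) = r *\<^sub>R e + y k" for r k
    by (subst e_eq) (simp add: y_def scaleR_sum_right scaleR_add_left sum.distrib)
  define t where "t k = (\<chi> l. u $ l + (\<Sum>i = 1..K. n k i * (s i $ l - u $ l)))" for k
  show thesis
  proof (rule that)
    show "int k < N k" for k using N[of k] by simp
    have "(\<lambda>k. \<Sum>i = 1..K. \<delta> k i *\<^sub>R (real_vec (s i) - ?u)) \<longlonglongrightarrow> (\<Sum>i = 1..K. 0 *\<^sub>R (real_vec (s i) - ?u))"
      by (intro tendsto_intros \<delta>0)
    then show "y \<longlonglongrightarrow> 0" by (simp add: y_def[abs_def])
    show "real_vec (t k) = ?u + real_of_int (N k) *\<^sub>R e + y k" for k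
    proof -
      have "real_vec (t k) = ?u + (\<Sum>i = 1..K. real_of_int (n k i) *\<^sub>R (real_vec (s i) - ?u))"
        by (simp add: t_def real_vec_def vec_eq_iff)
      also have "(\<Sum>i = 1..K. real_of_int (n k i) *\<^sub>R (real_vec (s i) - ?u)) = real_of_int (N k) *\<^sub>R e + y k"
        by (simp add: \<delta>_eq[symmetric] \<delta>_def)
      finally show ?thesis by (simp add: add.assoc)
    qed
    fix \<epsilon> :: real assume \<epsilon>: "0 < \<epsilon>" "\<epsilon> < 1"
    have "(\<lambda>k. \<Sum>i = 1..K. \<epsilon> * c i + \<delta> k i) \<longlonglongrightarrow> (\<Sum>i = 1..K. \<epsilon> * c i + 0)"
      by (intro tendsto_intros \<delta>0)
    then have "(\<lambda>k. \<Sum>i = 1..K. \<epsilon> * c i + \<delta> k i) \<longlonglongrightarrow> \<epsilon>"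
      using c(3) by (simp add: sum_distrib_left[symmetric])
    then have 1: "\<forall>\<^sub>F k in sequentially. (\<Sum>i = 1..K. \<epsilon> * c i + \<delta> k i) < 1"
      using \<epsilon>(2) by (rule order_tendstoD(2))
    have "\<forall>\<^sub>F k in sequentially. 0 \<le> \<epsilon> * c i + \<delta> k i" if i: "i \<in> {1..K}" for i
    proof (cases "c i = 0")
      case True
      then show ?thesis by (simp add: \<delta>_def n_def)
    next
      case False
      have "(\<lambda>k. \<epsilon> * c i + \<delta> k i) \<longlonglongrightarrow> \<epsilon> * c i + 0"
        by (intro tendsto_intros \<delta>0 i)
      moreover have "0 < \<epsilon> * c i + 0" using False c(1)[OF i] \<epsilon> by simp
      ultimately have "\<forall>\<^sub>F k in sequentially. 0 < \<epsilon> * c i + \<delta> k i"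
        by (rule order_tendstoD(1))
      then show ?thesis by (rule eventually_mono) simp
    qed
    then have 2: "\<forall>\<^sub>F k in sequentially. \<forall>i\<in>{1..K}. 0 \<le> \<epsilon> * c i + \<delta> k i"
      by (intro eventually_ball_finite) auto
    show "\<forall>\<^sub>F k in sequentially. ?u + \<epsilon> *\<^sub>R e + y k \<in> convex hull (real_vec ` D)"
      using 1 2
    proof eventually_elim
      case (elim k)
      have "?u + (\<Sum>i = 1..K. (\<epsilon> * c i + \<delta> k i) *\<^sub>R (real_vec (s i) - ?u)) \<in> convex hull (real_vec ` D)"
        by (rule convex_sum_le_one) (use elim s u in \<open>auto intro: hull_inc\<close>)
      moreover have "(\<Sum>i = 1..K. (\<epsilon> * c i + \<delta> k i) *\<^sub>R (real_vec (s i) - ?u)) = \<epsilon> *\<^sub>R e + y k"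
        by (rule \<delta>_eq)
      ultimately show ?case by (simp add: add.assoc)
    qed
  qed
qed

text \<open>Near \<open>u\<close> the extension has finitely many affine pieces, so one of them is
  active infinitely often at the points near the ray. Pushing these points forward along
  \<open>e\<close> reaches the lattice points \<open>t k\<close>, where the minorant
  \<open>p\<close> forces the piece to have slope \<open>p \<bullet> e\<close> along
  \<open>e\<close>; hence the piece is still active at \<open>t k\<close>.\<close>

lemma ex_subgradient_along:
  assumes p: "minorant p \<alpha>" and u: "u \<in> tight p \<alpha>" and e: "recdir p e"
  obtains q \<beta> N t y where "minorant q \<beta>" "u \<in> tight q \<beta>" "q \<bullet> e = p \<bullet> e"
    "\<And>k::nat. int k < N k" "y \<longlonglongrightarrow> 0"
    "\<And>k. real_vec (t k) = real_vec u + real_of_int (N k) *\<^sub>R e + y k"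
    "\<exists>\<^sub>F k in sequentially. t k \<in> tight q \<beta>"
proof -
  let ?u = "real_vec u"
  have uD: "u \<in> D" and Fu: "F u = p \<bullet> ?u + \<alpha>" using u by (auto simp: tight_def)
  obtain N t y where N: "\<And>k. int k < N k" and y: "y \<longlonglongrightarrow> 0"
    and t: "\<And>k. real_vec (t k) = ?u + real_of_int (N k) *\<^sub>R e + y k"
    and hull: "\<And>\<epsilon>. 0 < \<epsilon> \<Longrightarrow> \<epsilon> < 1 \<Longrightarrow> \<forall>\<^sub>F k in sequentially. ?u + \<epsilon> *\<^sub>R e + y k \<in> convex hull (real_vec ` D)"
    by (rule lattice_near_ray[OF uD e]) blast
  obtain M where fM: "finite M" and
    M1: "\<forall>(q, \<beta>)\<in>M. \<forall>(x, \<tau>)\<in>G. x \<in> cbox (?u - One) (?u + One) \<longrightarrow> q \<bullet> x + \<beta> \<le> \<tau>" and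
    M2: "\<forall>(x, \<tau>)\<in>G. x \<in> cbox (?u - One) (?u + One) \<longrightarrow> (\<exists>(q, \<beta>)\<in>M. (x, q \<bullet> x + \<beta>) \<in> G)"
    using G_loc[OF uD] by blast
  have M1: "q \<bullet> x + \<beta> \<le> \<tau>" if "(q, \<beta>) \<in> M" "(x, \<tau>) \<in> G" "x \<in> cbox (?u - One) (?u + One)" for q \<beta> x \<tau>
    using M1 that by blast
  have M2: "\<exists>z\<in>M. (x, fst z \<bullet> x + snd z) \<in> G" if "(x, \<tau>) \<in> G" "x \<in> cbox (?u - One) (?u + One)" for x \<tau>
    using bspec[OF M2 that(1)] that(2) by (simp add: case_prod_beta)
  define \<epsilon> where "\<epsilon> j = 1 / real (Suc (Suc j))" for j
  have \<epsilon>: "0 < \<epsilon> j" "\<epsilon> j < 1" for j by (simp_all add: \<epsilon>_def)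
  have \<epsilon>0: "\<epsilon> \<longlonglongrightarrow> 0"
    unfolding \<epsilon>_def using LIMSEQ_Suc[OF LIMSEQ_Suc[OF lim_1_over_n]] by simp
  define x where "x j k = ?u + \<epsilon> j *\<^sub>R e + y k" for j k
  have xlim: "(\<lambda>k. x j k) \<longlonglongrightarrow> ?u + \<epsilon> j *\<^sub>R e" for j
    unfolding x_def using tendsto_add[OF tendsto_const y] by fastforce
  have ulim: "(\<lambda>j. ?u + \<epsilon> j *\<^sub>R e) \<longlonglongrightarrow> ?u + 0 *\<^sub>R e"
    by (intro tendsto_intros \<epsilon>0)
  have "?u \<in> box (?u - One) (?u + One)"
    by (simp add: mem_box inner_diff_left inner_add_left)
  then have "\<forall>\<^sub>F j in sequentially. ?u + \<epsilon> j *\<^sub>R e \<in> box (?u - One) (?u + One)"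
    using topological_tendstoD[OF ulim open_box] by simp
  then have "\<forall>\<^sub>F j in sequentially. \<forall>\<^sub>F k in sequentially. \<exists>z\<in>M. (x j k, fst z \<bullet> x j k + snd z) \<in> G"
  proof eventually_elim
    case (elim j)
    have "\<forall>\<^sub>F k in sequentially. x j k \<in> box (?u - One) (?u + One)"
      by (rule topological_tendstoD[OF xlim open_box elim])
    with hull[OF \<epsilon>(1)[of j] \<epsilon>(2)[of j]] show ?case
    proof eventually_elim
      case (elim k)
      then obtain \<tau> where "(x j k, \<tau>) \<in> G" using G_over_hull by (auto simp: x_def)
      then show ?case using M2 elim(2) box_subset_cbox by blast
    qed
  qed
  then have "\<exists>\<^sub>F j in sequentially. \<exists>\<^sub>F k in sequentially. \<exists>z\<in>M. (x j k, fst z \<bullet> x j k + snd z) \<in> G"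
    by (intro eventually_frequently[OF sequentially_bot])
       (rule eventually_mono, assumption, rule eventually_frequently[OF sequentially_bot])
  \<comment> \<open>The pigeonhole principle is applied twice, over \<open>k\<close> for fixed
    \<open>j\<close> and then over \<open>j\<close>, to obtain a single piece.\<close>
  then have "\<exists>\<^sub>F j in sequentially. \<exists>z\<in>M. \<exists>\<^sub>F k in sequentially. (x j k, fst z \<bullet> x j k + snd z) \<in> G"
    by (rule frequently_elim1) (rule frequently_bex_finite[OF fM])
  then have "\<exists>z\<in>M. \<exists>\<^sub>F j in sequentially. \<exists>\<^sub>F k in sequentially. (x j k, fst z \<bullet> x j k + snd z) \<in> G"
    by (rule frequently_bex_finite[OF fM])
  then obtain z where z: "z \<in> M" "\<exists>\<^sub>F j in sequentially. \<exists>\<^sub>F k in sequentially. (x j k, fst z \<bullet> x j k + snd z) \<in> G"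
    by (rule bexE)
  obtain q \<beta> where zq: "z = (q, \<beta>)" by fastforce
  define good where "good j \<longleftrightarrow> (\<exists>\<^sub>F k in sequentially. (x j k, q \<bullet> x j k + \<beta>) \<in> G)" for j
  have good: "\<exists>\<^sub>F j in sequentially. good j" using z(2) by (simp add: good_def zq)
  have eG: "(?u + \<epsilon> j *\<^sub>R e, q \<bullet> (?u + \<epsilon> j *\<^sub>R e) + \<beta>) \<in> G" if "good j" for j
    by (rule frequently_closed_limit[OF G(2) _ that[unfolded good_def]])
       (intro tendsto_intros xlim)
  \<comment> \<open>As \<open>j\<close> tends to infinity, the piece is seen to be active at
    \<open>u\<close> itself.\<close>
  have "(\<lambda>j. (?u + \<epsilon> j *\<^sub>R e, q \<bullet> (?u + \<epsilon> j *\<^sub>R e) + \<beta>)) \<longlonglongrightarrow>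
      (?u + 0 *\<^sub>R e, q \<bullet> (?u + 0 *\<^sub>R e) + \<beta>)"
    by (intro tendsto_intros \<epsilon>0)
  then have "(?u + 0 *\<^sub>R e, q \<bullet> (?u + 0 *\<^sub>R e) + \<beta>) \<in> G"
    by (rule frequently_closed_limit[OF G(2)]) (rule frequently_elim1[OF good eG])
  then have "F u \<le> q \<bullet> ?u + \<beta>" using G_int by simp
  moreover have "q \<bullet> ?u + \<beta> \<le> F u"
    by (rule M1[OF _ G_gen[OF uD]]) (use z zq in \<open>auto simp: mem_box inner_diff_left inner_add_left\<close>)
  ultimately have Fq: "F u = q \<bullet> ?u + \<beta>" by simp
  have qG: "q \<bullet> x + \<beta> \<le> \<tau>" if "(x, \<tau>) \<in> G" for x \<tau>
    by (rule local_minorant_global[OF uD Fq _ that]) (use M1 z zq in auto)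
  obtain j where j: "good j" using good frequently_ex by blast
  have "(?u + \<epsilon> j *\<^sub>R e, F u + \<epsilon> j * (p \<bullet> e)) \<in> G"
    by (intro recdirD[OF e] G_gen uD) (use \<epsilon> less_imp_le in auto)
  from qG[OF this] have "\<epsilon> j * (q \<bullet> e) \<le> \<epsilon> j * (p \<bullet> e)" by (simp add: Fq inner_add_right)
  then have le: "q \<bullet> e \<le> p \<bullet> e" using \<epsilon>[of j] by simp
  \<comment> \<open>\<open>recdir p e\<close> carries \<open>x j k\<close> forward by
    \<open>N k - \<epsilon> j\<close> times \<open>e\<close> to the lattice point
    \<open>t k\<close>.\<close>
  have tF: "t k \<in> D \<and> F (t k) \<le> q \<bullet> x j k + \<beta> + (real_of_int (N k) - \<epsilon> j) * (p \<bullet> e)"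
    if "(x j k, q \<bullet> x j k + \<beta>) \<in> G" for k
  proof (rule G_int)
    have "(x j k + (real_of_int (N k) - \<epsilon> j) *\<^sub>R e, q \<bullet> x j k + \<beta> + (real_of_int (N k) - \<epsilon> j) * (p \<bullet> e)) \<in> G"
      by (rule recdirD[OF e that]) (use N[of k] \<epsilon>[of j] in linarith)
    moreover have "x j k + (real_of_int (N k) - \<epsilon> j) *\<^sub>R e = real_vec (t k)"
      by (simp add: x_def t scaleR_diff_left)
    ultimately show "(real_vec (t k), q \<bullet> x j k + \<beta> + (real_of_int (N k) - \<epsilon> j) * (p \<bullet> e)) \<in> G" by simp
  qed
  \<comment> \<open>Comparison with the minorant \<open>p\<close> at \<open>t k\<close> leaves only
    the error \<open>(q - p) \<bullet> y k\<close>, which tends to 0.\<close>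
  have "\<epsilon> j * (p \<bullet> e - q \<bullet> e) \<le> 0"
  proof (rule ccontr)
    assume "\<not> ?thesis"
    moreover have "(\<lambda>k. (q - p) \<bullet> y k) \<longlonglongrightarrow> (q - p) \<bullet> 0" by (intro tendsto_intros y)
    ultimately have "\<forall>\<^sub>F k in sequentially. (q - p) \<bullet> y k < \<epsilon> j * (p \<bullet> e - q \<bullet> e)"
      by (intro order_tendstoD(2)) auto
    then obtain k where k: "(x j k, q \<bullet> x j k + \<beta>) \<in> G" "(q - p) \<bullet> y k < \<epsilon> j * (p \<bullet> e - q \<bullet> e)"
      using frequently_eventuallyE[OF j[unfolded good_def]] by blast
    have "p \<bullet> real_vec (t k) + \<alpha> \<le> q \<bullet> x j k + \<beta> + (real_of_int (N k) - \<epsilon> j) * (p \<bullet> e)"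
      using p tF[OF k(1)] by (force simp: minorant_def)
    then show False using k(2) Fu Fq
      by (simp add: t x_def inner_add_right inner_diff_left algebra_simps)
  qed
  then have "p \<bullet> e \<le> q \<bullet> e" using \<epsilon>[of j] by (simp add: mult_le_0_iff)
  with le have qe: "q \<bullet> e = p \<bullet> e" by simp
  have qmin: "minorant q \<beta>" using qG G_gen by (auto simp: minorant_def)
  have "\<exists>\<^sub>F k in sequentially. t k \<in> tight q \<beta>"
    using j[unfolded good_def]
  proof (rule frequently_elim1)
    fix k assume "(x j k, q \<bullet> x j k + \<beta>) \<in> G"
    from tF[OF this] have "t k \<in> D" "F (t k) \<le> q \<bullet> real_vec (t k) + \<beta>"
      by (simp_all add: t x_def inner_add_right qe algebra_simps)
    then show "t k \<in> tight q \<beta>" using qmin by (force simp: tight_def minorant_def)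
  qed
  then show ?thesis
    using that[OF qmin _ qe N y t] uD Fq by (simp add: tight_def)
qed

text \<open>Suppose \<open>e\<close> increased the difference. So does the integral direction
  \<open>d\<close> obtained by cutting \<open>psum e\<close> at the level \<open>psum e j\<close>.
  The partial sum description of the contact set of a second minorant \<open>q\<close> shows that it
  contains \<open>u + d\<close> and \<open>t k - d\<close>. Comparing \<open>p\<close> and
  \<open>q\<close> at these points gives equal slopes along \<open>d\<close>, so
  \<open>u + d\<close> is a contact point of \<open>p\<close>, against the maximality of
  \<open>u\<close>.\<close>

lemma recdir_psum_le:
  assumes p: "minorant p \<alpha>" and u: "u \<in> tight p \<alpha>" and e: "recdir p e"
    and umax: "\<And>s. s \<in> tight p \<alpha> \<Longrightarrow> psum s j - psum s i \<le> psum u j - psum u i"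
  shows "psum e j \<le> psum e i"
proof (rule ccontr)
  assume ij: "\<not> psum e j \<le> psum e i"
  let ?u = "real_vec u"
  obtain q \<beta> N t y where q: "minorant q \<beta>" "u \<in> tight q \<beta>" "q \<bullet> e = p \<bullet> e"
    and N: "\<And>k::nat. int k < N k" and y: "y \<longlonglongrightarrow> 0"
    and t: "\<And>k. real_vec (t k) = ?u + real_of_int (N k) *\<^sub>R e + y k"
    and tq: "\<exists>\<^sub>F k in sequentially. t k \<in> tight q \<beta>"
    by (rule ex_subgradient_along[OF p u e]) blast
  have pt: "real_of_int (psum (t k) b) = real_of_int (psum u b) + real_of_int (N k) * psum e b + psum (y k) b" for k b
    by (simp add: psum_real_vec[symmetric] t psum_add psum_scaleR)
  \<comment> \<open>Every strict increase of \<open>psum e\<close> eventually yields an integral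
    gain of at least 1, which is all that the 0-1 function \<xi> requires.\<close>
  have far: "\<forall>\<^sub>F k in sequentially. psum e a < psum e b \<longrightarrow>
      psum (t k) b - psum (t k) a \<ge> psum u b - psum u a + 1" for a b
  proof (cases "psum e a < psum e b")
    case True
    have 1: "(\<lambda>k. psum (y k) b - psum (y k) a) \<longlonglongrightarrow> psum 0 b - psum 0 a"
      by (intro tendsto_intros bounded_linear.tendsto[OF bounded_linear_psum y])
    have "psum (0::(real,'n) vec) b - psum (0::(real,'n) vec) a = 0"
      using psum_scaleR[of 0 "0::(real,'n) vec"] by simp
    with 1 have 1: "\<forall>\<^sub>F k in sequentially. - 1 < psum (y k) b - psum (y k) a"
      by (intro order_tendstoD(1)) auto
    have "filterlim (\<lambda>k. (psum e b - psum e a) * real k) at_top sequentially"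
      using True by (intro filterlim_tendsto_pos_mult_at_top[OF tendsto_const] filterlim_real_sequentially) auto
    then have "\<forall>\<^sub>F k in sequentially. 2 \<le> (psum e b - psum e a) * real k"
      by (auto simp: filterlim_at_top)
    with 1 show ?thesis
    proof eventually_elim
      case (elim k)
      have "(psum e b - psum e a) * real k \<le> (psum e b - psum e a) * real_of_int (N k)"
        using True N[of k] by (intro mult_left_mono) linarith+
      then have "real_of_int (psum (t k) b - psum (t k) a) \<ge> real_of_int (psum u b - psum u a + 1)"
        using elim by (simp add: pt algebra_simps)
      then have "psum u b - psum u a + 1 \<le> psum (t k) b - psum (t k) a" by (simp only: of_int_le_iff)
      then show ?case by simp
    qed
  qed simp
  then have far: "\<forall>\<^sub>F k in sequentially. \<forall>a b. psum e a < psum e b \<longrightarrow>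
      psum (t k) b - psum (t k) a \<ge> psum u b - psum u a + 1"
    by (intro eventually_all_finite)
  define \<xi> :: "'n option \<Rightarrow> int" where "\<xi> b = (if psum e j \<le> psum e b then 1 else 0)" for b
  define d where "d = diffs \<xi>"
  have pd: "psum d b = \<xi> b - \<xi> None" for b by (simp add: d_def psum_diffs)
  have \<xi>: "\<xi> b \<le> \<xi> a + 1" "\<xi> a < \<xi> b \<Longrightarrow> psum e a < psum e b" for a b
    by (auto simp: \<xi>_def split: if_splits)
  have ud: "u + d \<in> tight q \<beta>"
  proof (rule lset_memI[OF lset_tight[OF q(1)]])
    fix a b
    obtain k where k: "t k \<in> tight q \<beta>" "\<And>a b. psum e a < psum e b \<Longrightarrow>
      psum (t k) b - psum (t k) a \<ge> psum u b - psum u a + 1"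
      using frequently_eventuallyE[OF tq far] by blast
    show "\<exists>s\<in>tight q \<beta>. psum (u + d) b - psum (u + d) a \<le> psum s b - psum s a"
    proof (cases "\<xi> a < \<xi> b")
      case True
      then show ?thesis using k(2)[OF \<xi>(2)[OF True]] k(1) \<xi>(1)[of b a]
        by (intro bexI[of _ "t k"]) (simp_all add: psum_add pd)
    next
      case False
      then show ?thesis using q(2) by (intro bexI[of _ u]) (simp_all add: psum_add pd)
    qed
  qed
  have td: "t k - d \<in> tight q \<beta>" if k: "t k \<in> tight q \<beta>" "\<And>a b. psum e a < psum e b \<Longrightarrow>
      psum (t k) b - psum (t k) a \<ge> psum u b - psum u a + 1" for k
  proof (rule lset_memI[OF lset_tight[OF q(1)]])
    fix a b
    show "\<exists>s\<in>tight q \<beta>. psum (t k - d) b - psum (t k - d) a \<le> psum s b - psum s a"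
    proof (cases "\<xi> b < \<xi> a")
      case True
      then show ?thesis using k(2)[OF \<xi>(2)[OF True]] q(2) \<xi>(1)[of a b]
        by (intro bexI[of _ u]) (simp_all add: psum_diff pd)
    next
      case False
      then show ?thesis using k(1) by (intro bexI[of _ "t k"]) (simp_all add: psum_diff pd)
    qed
  qed
  have gap: "p \<bullet> (real_vec s - ?u) \<le> q \<bullet> (real_vec s - ?u)" if "s \<in> tight q \<beta>" for s
    using that p u q(2) by (force simp: tight_def minorant_def inner_diff_right)
  have ge: "(q - p) \<bullet> real_vec d \<ge> 0"
    using gap[OF ud] by (simp add: real_vec_add inner_diff_left)
  \<comment> \<open>\<open>t k - d - u\<close> is a multiple of \<open>e\<close> plus
    \<open>y k - d\<close>. The slopes agree on \<open>e\<close> and \<open>y k\<close> tends to 0,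
    so only \<open>- d\<close> counts in the limit.\<close>
  have le: "(q - p) \<bullet> real_vec d \<le> 0"
  proof (rule ccontr)
    assume "\<not> ?thesis"
    moreover have "(\<lambda>k. (q - p) \<bullet> y k) \<longlonglongrightarrow> (q - p) \<bullet> 0" by (intro tendsto_intros y)
    ultimately have "\<forall>\<^sub>F k in sequentially. (q - p) \<bullet> y k < (q - p) \<bullet> real_vec d"
      by (intro order_tendstoD(2)) auto
    then obtain k where k: "(q - p) \<bullet> y k < (q - p) \<bullet> real_vec d" "t k \<in> tight q \<beta>"
       "\<And>a b. psum e a < psum e b \<Longrightarrow> psum (t k) b - psum (t k) a \<ge> psum u b - psum u a + 1"
      using frequently_eventuallyE[OF tq eventually_conj[OF far]] by blast
    have "p \<bullet> (real_vec (t k - d) - ?u) \<le> q \<bullet> (real_vec (t k - d) - ?u)"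
      by (rule gap[OF td[OF k(2,3)]])
    then show False using k(1) q(3)
      by (simp add: real_vec_diff t inner_diff_left inner_diff_right inner_add_right)
  qed
  have "u + d \<in> tight p \<alpha>"
    using ud ge le q(2) u by (simp add: tight_def real_vec_add inner_add_right inner_diff_left)
  from umax[OF this] have "\<xi> j \<le> \<xi> i" by (simp add: psum_add pd)
  then show False using ij by (simp add: \<xi>_def split: if_splits)
qed

end

section \<open>Escape of lattice points to infinity\<close>

context extensible_lsets
begin

section \<open>Lineality directions and the lattice vectors among them\<close>

definition lin :: "(real, 'n) vec \<Rightarrow> (real, 'n) vec \<Rightarrow> bool" where
  "lin p d \<longleftrightarrow> recdir p d \<and> recdir p (- d)"

text \<open>Along a full line the minorant \<open>p0\<close> of \<open>G\<close> must have the same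
  slope as \<open>p\<close>, so \<open>recdir_psum_le\<close> applies to both \<open>d\<close> and
  \<open>- d\<close>. The bound \<open>c\<close> ensures that the integral difference attains its
  maximum on the contact set.\<close>

lemma lin_psum_eq:
  assumes p0: "\<And>x \<tau>. (x, \<tau>) \<in> G \<Longrightarrow> p0 \<bullet> x + \<beta>0 \<le> \<tau>" "minorant p0 \<beta>0" "tight p0 \<beta>0 \<noteq> {}"
    and d: "lin p d"
    and c: "\<And>s. s \<in> tight p0 \<beta>0 \<Longrightarrow> psum s j - psum s i \<le> c"
  shows "psum d i = psum d j"
proof -
  obtain u where u: "u \<in> tight p0 \<beta>0" using p0(3) by blast
  have uD: "(real_vec u, F u) \<in> G" "F u = p0 \<bullet> real_vec u + \<beta>0" using u G_gen[of u] by (simp_all add: tight_def)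
  have "p0 \<bullet> d \<le> p \<bullet> d"
    using p0(1)[OF recdirD[OF _ uD(1), of p d 1]] d uD(2) by (simp add: lin_def inner_add_right)
  moreover have "p \<bullet> d \<le> p0 \<bullet> d"
    using p0(1)[OF recdirD[OF _ uD(1), of p "- d" 1]] d uD(2) by (simp add: lin_def inner_diff_right)
  ultimately have eq: "p \<bullet> d = p0 \<bullet> d" by simp
  have "recdir p0 d" "recdir p0 (- d)"
    using d recdir_cong[of p d p0] recdir_cong[of p "- d" p0] by (simp_all add: lin_def eq)
  moreover obtain v where v: "v \<in> tight p0 \<beta>0"
    "\<And>s. s \<in> tight p0 \<beta>0 \<Longrightarrow> psum s j - psum s i \<le> psum v j - psum v i"
  proof -
    let ?w = "\<lambda>s. nat (c - (psum s j - psum s i))"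
    obtain v where v: "v \<in> tight p0 \<beta>0" "\<And>s. s \<in> tight p0 \<beta>0 \<Longrightarrow> ?w v \<le> ?w s"
      using ex_has_least_nat[of "\<lambda>s. s \<in> tight p0 \<beta>0" u ?w] u by blast
    show thesis by (rule that[OF v(1)]) (use v(2) c in \<open>fastforce simp: nat_le_eq_zle\<close>)
  qed
  ultimately have "psum d j \<le> psum d i" "psum (- d) j \<le> psum (- d) i"
    using recdir_psum_le[OF p0(2) v(1)] by blast+
  then show ?thesis by (simp add: psum_uminus)
qed

text \<open>By \<open>lset_memI\<close> the whole lattice line through \<open>u\<close> along
  \<open>l\<close> lies in the contact set of \<open>p0\<close>, so \<open>F\<close> is affine on
  it. A second minorant \<open>p\<close> must have the same slope along such a line.\<close>

lemma lattice_recdir: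
  assumes p0: "minorant p0 \<beta>0" and u: "u \<in> tight p0 \<beta>0"
    and p: "minorant p \<alpha>"
    and l: "\<And>i j c. (\<And>s. s \<in> tight p0 \<beta>0 \<Longrightarrow> psum s j - psum s i \<le> c) \<Longrightarrow> psum l i = psum l j"
  shows "recdir p (real_vec l)"
proof -
  define t where "t m = (\<chi> k. u $ k + m * l $ k)" for m :: int
  have rt: "real_vec (t m) = real_vec u + real_of_int m *\<^sub>R real_vec l" for m
    by (simp add: t_def real_vec_def vec_eq_iff)
  have pt: "psum (t m) k = psum u k + m * psum l k" for m k
    by (cases k) (simp_all add: psum_def t_def sum.distrib sum_distrib_left)
  have tt: "t m \<in> tight p0 \<beta>0" for m
  proof (rule lset_memI[OF lset_tight[OF p0]])
    fix i j
    show "\<exists>s\<in>tight p0 \<beta>0. psum (t m) j - psum (t m) i \<le> psum s j - psum s i"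
    proof (cases "\<exists>c. \<forall>s\<in>tight p0 \<beta>0. psum s j - psum s i \<le> c")
      case True
      then have "psum l i = psum l j" using l by blast
      then show ?thesis using u by (intro bexI[of _ u]) (simp_all add: pt)
    next
      case False
      then show ?thesis by (meson linear)
    qed
  qed
  have F: "F (t m) = F u + real_of_int m * (p0 \<bullet> real_vec l)" for m
    using tt[of m] u by (simp add: tight_def rt inner_add_right)
  have ge: "p \<bullet> real_vec u + \<alpha> - F u \<le> real_of_int m * (p0 \<bullet> real_vec l - p \<bullet> real_vec l)" for m
  proof -
    have "t m \<in> D" using tt[of m] by (simp add: tight_def)
    then have "p \<bullet> real_vec (t m) + \<alpha> \<le> F (t m)" using p by (simp add: minorant_def)
    then show ?thesis by (simp add: F rt inner_add_right algebra_simps)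
  qed
  have eq: "p0 \<bullet> real_vec l = p \<bullet> real_vec l"
  proof (rule ccontr)
    assume ne: "p0 \<bullet> real_vec l \<noteq> p \<bullet> real_vec l"
    define a where "a = p0 \<bullet> real_vec l - p \<bullet> real_vec l"
    obtain n where n: "\<bar>p \<bullet> real_vec u + \<alpha> - F u\<bar> < real n * \<bar>a\<bar>"
      using reals_Archimedean3[of "\<bar>a\<bar>"] ne by (auto simp: a_def)
    show False
    proof (cases "a \<ge> 0")
      case True
      then show ?thesis using ge[of "- int n"] n by (simp add: a_def[symmetric])
    next
      case False
      then show ?thesis using ge[of "int n"] n by (simp add: a_def[symmetric])
    qed
  qed
  show ?thesis
  proof (rule recdir_limit[of "\<lambda>k. t (int (Suc k))" "\<lambda>k. real (Suc k)" _ p \<alpha>])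
    show "t (int (Suc k)) \<in> D" for k using tt[of "int (Suc k)"] by (simp add: tight_def)
    show "filterlim (\<lambda>k. real (Suc k)) at_top sequentially"
      by (rule filterlim_compose[OF filterlim_real_sequentially filterlim_Suc])
    have inv: "(\<lambda>k. 1 / real (Suc k)) \<longlonglongrightarrow> 0" by (rule LIMSEQ_Suc[OF lim_1_over_n])
    have "(\<lambda>k. (1 / real (Suc k)) *\<^sub>R real_vec u + real_vec l) \<longlonglongrightarrow> 0 *\<^sub>R real_vec u + real_vec l"
      by (intro tendsto_intros inv)
    then show "(\<lambda>k. (1 / real (Suc k)) *\<^sub>R real_vec (t (int (Suc k)))) \<longlonglongrightarrow> real_vec l"
      by (simp add: rt scaleR_add_right)
    have "(\<lambda>k. (1 / real (Suc k)) * (F u - p \<bullet> real_vec u - \<alpha>)) \<longlonglongrightarrow> 0 * (F u - p \<bullet> real_vec u - \<alpha>)"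
      by (intro tendsto_intros inv)
    then show "(\<lambda>k. (F (t (int (Suc k))) - p \<bullet> real_vec (t (int (Suc k))) - \<alpha>) / real (Suc k)) \<longlonglongrightarrow> 0"
      by (simp add: F rt inner_add_right eq add.commute)
  qed
qed

text \<open>The gap of \<open>s k\<close> is small relative to its norm. If the norms are bounded
  infinitely often, some lattice point recurs and its gap must be 0; otherwise compactness of the
  unit ball provides a limit direction, to which \<open>recdir_limit\<close> applies.\<close>

lemma ray_limit:
  assumes p: "minorant p \<alpha>" and s: "\<And>k. s k \<in> D" and "0 \<le> C"
    and small: "\<And>k. (F (s k) - p \<bullet> real_vec (s k) - \<alpha>) * real (Suc k) \<le> C * (1 + norm (real_vec (s k)))"
  shows "(\<exists>t\<in>tight p \<alpha>. \<exists>\<^sub>F k in sequentially. s k = t) \<or>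
    (\<exists>r d. strict_mono r \<and> norm d = 1 \<and> recdir p d \<and>
       filterlim (\<lambda>k. norm (real_vec (s (r k)))) at_top sequentially \<and>
       (\<lambda>k. (1 / norm (real_vec (s (r k)))) *\<^sub>R real_vec (s (r k))) \<longlonglongrightarrow> d)"
proof (cases "\<exists>R. \<exists>\<^sub>F k in sequentially. norm (real_vec (s k)) \<le> R")
  case True
  then obtain R where "\<exists>\<^sub>F k in sequentially. norm (real_vec (s k)) \<le> R" by blast
  then have "\<exists>\<^sub>F k in sequentially. \<exists>t\<in>{t. norm (real_vec t) \<le> R}. s k = t"
    by (rule frequently_elim1) simp
  from frequently_bex_finite[OF finite_lattice_bounded this]
  obtain t where t: "\<exists>\<^sub>F k in sequentially. s k = t" by blast
  then have tD: "t \<in> D" using frequently_ex s by blast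
  have "F t - p \<bullet> real_vec t - \<alpha> \<le> 0"
  proof (rule ccontr)
    assume pos: "\<not> ?thesis"
    obtain n where n: "C * (1 + norm (real_vec t)) < real n * (F t - p \<bullet> real_vec t - \<alpha>)"
      using reals_Archimedean3 pos by (metis not_le)
    obtain k where k: "s k = t" "n \<le> k"
      using frequently_eventuallyE[OF t eventually_ge_at_top[of n]] by blast
    have "real n * (F t - p \<bullet> real_vec t - \<alpha>) \<le> real (Suc k) * (F t - p \<bullet> real_vec t - \<alpha>)"
      using pos k(2) by (intro mult_right_mono) auto
    then show False using small[of k] n k(1) by (simp add: mult.commute)
  qed
  moreover have "F t - p \<bullet> real_vec t - \<alpha> \<ge> 0" using p tD by (force simp: minorant_def)
  ultimately have "t \<in> tight p \<alpha>" using tD by (simp add: tight_def)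
  then show ?thesis using t by blast
next
  case False
  define \<nu> where "\<nu> k = norm (real_vec (s k))" for k
  have "\<forall>\<^sub>F k in sequentially. R \<le> \<nu> k" for R
  proof -
    have "\<forall>\<^sub>F k in sequentially. \<not> \<nu> k \<le> R" using False by (simp add: \<nu>_def not_frequently)
    then show ?thesis by (rule eventually_mono) simp
  qed
  then have \<nu>: "filterlim \<nu> at_top sequentially" by (simp add: filterlim_at_top)
  have "(1 / \<nu> k) *\<^sub>R real_vec (s k) \<in> cball 0 1" for k
    by (simp add: \<nu>_def)
  then obtain d r where dr: "strict_mono r" "((\<lambda>k. (1 / \<nu> k) *\<^sub>R real_vec (s k)) \<circ> r) \<longlonglongrightarrow> d"
    using compact_cball[of "0 :: (real, 'n) vec" 1] unfolding compact_def by meson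
  have \<nu>r: "filterlim (\<lambda>k. \<nu> (r k)) at_top sequentially"
    by (rule filterlim_compose[OF \<nu> filterlim_subseq[OF dr(1)]])
  then have pos: "\<forall>\<^sub>F k in sequentially. 1 \<le> \<nu> (r k)" by (simp add: filterlim_at_top)
  have lim: "(\<lambda>k. (1 / \<nu> (r k)) *\<^sub>R real_vec (s (r k))) \<longlonglongrightarrow> d" using dr(2) by (simp add: o_def)
  have "\<forall>\<^sub>F k in sequentially. norm ((1 / \<nu> (r k)) *\<^sub>R real_vec (s (r k))) = 1"
    using pos by eventually_elim (auto simp: \<nu>_def)
  then have "norm d = 1"
    by (intro LIMSEQ_unique[OF tendsto_norm[OF lim]] tendsto_eventually)
  moreover have "recdir p d"
  proof (rule recdir_limit[OF s \<nu>r lim])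
    show "(\<lambda>k. (F (s (r k)) - p \<bullet> real_vec (s (r k)) - \<alpha>) / \<nu> (r k)) \<longlonglongrightarrow> 0"
    proof (rule tendsto_sandwich[of "\<lambda>_. 0" _ _ "\<lambda>k. 2 * C * (1 / real (Suc (r k)))"])
      show "\<forall>\<^sub>F k in sequentially. 0 \<le> (F (s (r k)) - p \<bullet> real_vec (s (r k)) - \<alpha>) / \<nu> (r k)"
        using p s by (intro always_eventually allI divide_nonneg_nonneg) (auto simp: minorant_def \<nu>_def algebra_simps)
      show "\<forall>\<^sub>F k in sequentially. (F (s (r k)) - p \<bullet> real_vec (s (r k)) - \<alpha>) / \<nu> (r k) \<le> 2 * C * (1 / real (Suc (r k)))"
        using pos
      proof eventually_elim
        case (elim k)
        have "(F (s (r k)) - p \<bullet> real_vec (s (r k)) - \<alpha>) * real (Suc (r k)) \<le> C * (1 + \<nu> (r k))"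
          using small[of "r k"] by (simp add: \<nu>_def)
        also have "\<dots> \<le> C * (2 * \<nu> (r k))" using elim \<open>0 \<le> C\<close> by (intro mult_left_mono) auto
        finally show ?case using elim by (simp add: divide_simps mult.commute mult.left_commute del: of_nat_Suc)
      qed
      have "(\<lambda>k. 2 * C * (1 / real (Suc (r k)))) \<longlonglongrightarrow> 2 * C * 0"
        using LIMSEQ_subseq_LIMSEQ[OF LIMSEQ_Suc[OF lim_1_over_n] dr(1)]
        by (intro tendsto_intros) (simp add: o_def)
      then show "(\<lambda>k. 2 * C * (1 / real (Suc (r k)))) \<longlonglongrightarrow> 0" by simp
    qed simp
  qed
  ultimately show ?thesis using dr(1) \<nu>r lim unfolding \<nu>_def by blast
qed

text \<open>Along directions in which the minorant stays asymptotically tight, the hypothesis on \<open>L\<close> gives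
  \<open>L d \<le> 0\<close>. After factoring out the lattice of lineality directions these directions form a pointed
  cone, so that a functional \<open>\<psi>\<close> positive on this cone controls the escape of lattice points to infinity.\<close>

lemma linear_le_at_touch:
  assumes p: "minorant p \<alpha>" and x: "(x, p \<bullet> x + \<alpha>) \<in> epi_hull"
    and L: "linear L" "\<And>d. recdir p d \<Longrightarrow> L d \<le> 0"
    and tight: "\<And>s. s \<in> tight p \<alpha> \<Longrightarrow> L (real_vec s) + \<beta> \<le> 0"
  shows "L x + \<beta> \<le> (0::real)"
proof -
  have blL: "bounded_linear L" using L(1) linear_conv_bounded_linear by blast
  have "D \<noteq> {}" using x by (auto simp: epi_hull_def)
  then obtain u0 where "u0 \<in> D" by blast
  then obtain p0 \<beta>0 where p0: "\<And>x \<tau>. (x, \<tau>) \<in> G \<Longrightarrow> p0 \<bullet> x + \<beta>0 \<le> \<tau>" "u0 \<in> tight p0 \<beta>0" "minorant p0 \<beta>0"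
    by (rule ex_subgradient) blast
  \<comment> \<open>Indices with equal partial sums in all lineality directions form a class. The
    choice depends only on the class, so \<rho> selects one representative of each.\<close>
  define \<rho> where "\<rho> i = (SOME k. \<forall>d. lin p d \<longrightarrow> psum d k = psum d i)" for i
  have \<rho>: "psum d (\<rho> i) = psum d i" if "lin p d" for d i
    using someI[of "\<lambda>k. \<forall>d. lin p d \<longrightarrow> psum d k = psum d i" i] that by (simp add: \<rho>_def)
  have \<rho>_eq: "\<rho> i = \<rho> j" if "\<And>d. lin p d \<Longrightarrow> psum d i = psum d j" for i j
    using that by (simp add: \<rho>_def cong: imp_cong)
  have \<rho>\<rho>: "\<rho> (\<rho> i) = \<rho> i" for i by (rule \<rho>_eq) (rule \<rho>)
  \<comment> \<open>Subtracting the value at the representative annihilates lineality directions and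
    preserves integrality, whence the integral version \<open>redi\<close>.\<close>
  define red where "red v = diffs (\<lambda>i. psum v i - psum v (\<rho> i))" for v :: "(real, 'n) vec"
  define redi where "redi v = diffs (\<lambda>i. psum v i - psum v (\<rho> i))" for v :: "(int, 'n) vec"
  have rv_red: "real_vec (redi t) = red (real_vec t)" for t
    by (simp add: red_def redi_def diffs_real_vec psum_real_vec)
  have linred: "linear red"
    by (rule linearI) (simp_all add: red_def diffs_def vec_eq_iff psum_add psum_scaleR algebra_simps)
  then have blred: "bounded_linear red" using linear_conv_bounded_linear by blast
  have red_lin: "red d = 0" if "lin p d" for d
    using \<rho>[OF that] by (simp add: red_def diffs_def vec_eq_iff)
  have redi_red: "red (real_vec (redi t)) = real_vec (redi t)" for t
    unfolding rv_red by (simp add: red_def psum_diffs \<rho>\<rho>)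
  \<comment> \<open>The partial sums of \<open>t - redi t\<close> are constant on the classes, so
    \<open>lin_psum_eq\<close> and \<open>lattice_recdir\<close> make it a lineality
    direction.\<close>
  have lat: "recdir p (real_vec (t - redi t)) \<and> recdir p (- real_vec (t - redi t))" for t
  proof -
    have "t - redi t = diffs (\<lambda>i. psum t (\<rho> i))"
      using diffs_diff[of "psum t" "\<lambda>i. psum t i - psum t (\<rho> i)"] by (simp add: redi_def diffs_psum)
    then have l: "psum (t - redi t) k = psum t (\<rho> k) - psum t (\<rho> None)" for k by (simp add: psum_diffs)
    have eq: "psum (t - redi t) i = psum (t - redi t) j"
      if "\<And>s. s \<in> tight p0 \<beta>0 \<Longrightarrow> psum s j - psum s i \<le> c" for i j c
    proof -
      have "\<rho> i = \<rho> j"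
        by (rule \<rho>_eq, rule lin_psum_eq[OF p0(1,3)]) (use p0(2) that in auto)
      then show ?thesis by (simp add: l)
    qed
    have "recdir p (real_vec (t - redi t))" by (rule lattice_recdir[OF p0(3,2) p eq])
    moreover have "recdir p (real_vec (- (t - redi t)))"
      by (rule lattice_recdir[OF p0(3,2) p]) (metis eq psum_uminus)
    ultimately show ?thesis unfolding real_vec_uminus by (rule conjI)
  qed
  have redi_D: "redi t \<in> D \<and> F (redi t) - p \<bullet> real_vec (redi t) \<le> F t - p \<bullet> real_vec t" if "t \<in> D" for t
  proof -
    have "(real_vec t + 1 *\<^sub>R (- real_vec (t - redi t)), F t + 1 * (p \<bullet> (- real_vec (t - redi t)))) \<in> G"
      by (rule recdirD) (use lat G_gen that in auto)
    then have "(real_vec (redi t), F t - p \<bullet> real_vec t + p \<bullet> real_vec (redi t)) \<in> G"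
      by (simp add: real_vec_diff inner_diff_right algebra_simps)
    from G_int[OF this] show ?thesis by simp
  qed
  have L_red: "L (real_vec (redi t)) = L (real_vec t)" for t
  proof -
    have "L (real_vec (t - redi t)) = 0"
      using lat[of t] L(2)[of "real_vec (t - redi t)"] L(2)[of "- real_vec (t - redi t)"] linear_neg[OF L(1)] by force
    then show ?thesis by (simp add: real_vec_diff linear_diff[OF L(1)])
  qed
  \<comment> \<open>This cone is pointed: if it contains \<open>d\<close> and \<open>- d\<close>,
    then \<open>d\<close> is a lineality direction, which \<open>red\<close> maps to 0.\<close>
  define K where "K = {d. recdir p d \<and> red d = d}"
  have K0: "d = 0" if "d \<in> K" "- d \<in> K" for d
    using that red_lin[of d] by (simp add: K_def lin_def)
  have K_add: "d + e \<in> K" if "d \<in> K" "e \<in> K" for d e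
    using that recdir_add linear_add[OF linred] by (simp add: K_def)
  have K_scale: "c *\<^sub>R d \<in> K" if "d \<in> K" "0 \<le> c" for c d
    using that recdir_scale linear_cmul[OF linred] by (simp add: K_def)
  have "closed K"
  proof -
    have "K = {d. recdir p d} \<inter> {d. red d = d}" by (auto simp: K_def)
    moreover have "closed {d. red d = d}"
      by (intro closed_Collect_eq bounded_linear.continuous_on[OF blred] continuous_intros)
    ultimately show ?thesis using closed_recdir by auto
  qed
  then have "compact (K \<inter> sphere 0 1)" by (metis closed_Int_compact compact_sphere)
  then have cC: "compact (convex hull (K \<inter> sphere 0 1))" by (rule compact_convex_hull)
  \<comment> \<open>Pointedness keeps the compact hull of the unit vectors of \<open>K\<close> away
    from 0, so that 0 can be strictly separated from it.\<close>
  have "convex (K - {0})"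
  proof (rule convexI)
    fix d e and a b :: real
    assume d: "d \<in> K - {0}" and e: "e \<in> K - {0}" and ab: "0 \<le> a" "0 \<le> b" "a + b = 1"
    have "a *\<^sub>R d + b *\<^sub>R e \<noteq> 0"
    proof
      assume 0: "a *\<^sub>R d + b *\<^sub>R e = 0"
      then have "- (a *\<^sub>R d) = b *\<^sub>R e" by (rule minus_unique)
      then have "- (a *\<^sub>R d) \<in> K" using K_scale e ab by simp
      then have "a *\<^sub>R d = 0" using K0 K_scale d ab by blast
      then have "a = 0" using d by simp
      then show False using 0 e ab by simp
    qed
    then show "a *\<^sub>R d + b *\<^sub>R e \<in> K - {0}" using K_add K_scale d e ab by simp
  qed
  then have "convex hull (K \<inter> sphere 0 1) \<subseteq> K - {0}" by (intro hull_minimal) auto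
  then obtain \<psi> b where \<psi>b: "0 < b" "\<And>d. d \<in> convex hull (K \<inter> sphere 0 1) \<Longrightarrow> b < \<psi> \<bullet> d"
    using separating_hyperplane_closed_0[OF convex_convex_hull compact_imp_closed[OF cC]] by blast
  have \<psi>: "0 < \<psi> \<bullet> d" if "d \<in> K" "norm d = 1" for d
    using \<psi>b(1) \<psi>b(2)[OF hull_inc] that by fastforce
  have K_limit: "d \<in> K" if "recdir p d" "\<And>k. red (real_vec (s k)) = real_vec (s k)"
      "(\<lambda>k. (1 / norm (real_vec (s k))) *\<^sub>R real_vec (s k)) \<longlonglongrightarrow> d" for s d
  proof -
    have "(\<lambda>k. red ((1 / norm (real_vec (s k))) *\<^sub>R real_vec (s k))) \<longlonglongrightarrow> red d"
      by (rule bounded_linear.tendsto[OF blred that(3)])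
    then have "(\<lambda>k. (1 / norm (real_vec (s k))) *\<^sub>R real_vec (s k)) \<longlonglongrightarrow> red d"
      by (simp add: linear_cmul[OF linred] that(2))
    then have "red d = d" using that(3) LIMSEQ_unique by blast
    then show ?thesis using that(1) by (simp add: K_def)
  qed
  \<comment> \<open>Otherwise reduced contact points would escape in a direction of \<open>K\<close>
    on which \<psi> is nonpositive.\<close>
  have "\<exists>A. \<forall>s\<in>tight p \<alpha>. red (real_vec s) = real_vec s \<longrightarrow> 0 \<le> \<psi> \<bullet> real_vec s + A"
  proof (rule ccontr)
    assume "\<not> ?thesis"
    then have "\<forall>k. \<exists>s. s \<in> tight p \<alpha> \<and> red (real_vec s) = real_vec s \<and> \<psi> \<bullet> real_vec s + real k < 0"
      by (meson not_le)
    then obtain s where s: "\<And>k. s k \<in> tight p \<alpha>" "\<And>k. red (real_vec (s k)) = real_vec (s k)"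
       "\<And>k. \<psi> \<bullet> real_vec (s k) + real k < 0" by metis
    have "s k \<in> D" "(F (s k) - p \<bullet> real_vec (s k) - \<alpha>) * real (Suc k) \<le> 0 * (1 + norm (real_vec (s k)))" for k
      using s(1)[of k] by (auto simp: tight_def)
    from ray_limit[OF p this(1) order_refl this(2)] show False
    proof (elim disjE exE conjE bexE)
      fix t assume t: "\<exists>\<^sub>F k in sequentially. s k = t"
      obtain n where n: "- (\<psi> \<bullet> real_vec t) < real n" using reals_Archimedean2 by blast
      obtain k where "s k = t" "n \<le> k"
        using frequently_eventuallyE[OF t eventually_ge_at_top[of n]] by blast
      then show False using s(3)[of k] n by simp
    next
      fix r d assume r: "norm d = 1" "recdir p d"
        "(\<lambda>k. (1 / norm (real_vec (s (r k)))) *\<^sub>R real_vec (s (r k))) \<longlonglongrightarrow> d"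
      have "(\<lambda>k. \<psi> \<bullet> ((1 / norm (real_vec (s (r k)))) *\<^sub>R real_vec (s (r k)))) \<longlonglongrightarrow> \<psi> \<bullet> d"
        by (intro tendsto_intros r)
      moreover have "\<psi> \<bullet> real_vec (s k) \<le> 0" for k using s(3)[of k] by linarith
      then have "\<psi> \<bullet> ((1 / norm (real_vec (s (r k)))) *\<^sub>R real_vec (s (r k))) \<le> 0" for k
        by (simp add: divide_nonpos_nonneg)
      ultimately have "\<psi> \<bullet> d \<le> 0" by (intro LIMSEQ_le_const2) auto
      moreover have "d \<in> K" by (rule K_limit[OF r(2) _ r(3)]) (rule s(2))
      ultimately show False using \<psi> r(1) by fastforce
    qed
  qed
  then obtain A where A: "\<And>s. s \<in> tight p \<alpha> \<Longrightarrow> red (real_vec s) = real_vec s \<Longrightarrow> 0 \<le> \<psi> \<bullet> real_vec s + A"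
    by blast
  \<comment> \<open>The term with \<theta> creates strictness: \<open>L d \<le> 0\<close> alone does
    not exclude escaping sequences, but \<open>L d < \<theta> * (\<psi> \<bullet> d)\<close> on the
    unit vectors of \<open>K\<close> does.\<close>
  have bound: "L x + \<beta> \<le> \<theta> * (\<psi> \<bullet> red x + A)" if \<theta>: "0 < \<theta>" for \<theta>
  proof -
    have "\<exists>B\<ge>0. \<forall>s\<in>D. red (real_vec s) = real_vec s \<longrightarrow>
        L (real_vec s) + \<beta> \<le> \<theta> * (\<psi> \<bullet> real_vec s + A) + B * (F s - p \<bullet> real_vec s - \<alpha>)"
    proof (rule ccontr)
      assume neg: "\<not> ?thesis"
      \<comment> \<open>If no multiplier \<open>B\<close> works, then \<open>Suc k\<close> fails at
        points \<open>s k\<close> whose gaps are small enough for \<open>ray_limit\<close>.\<close>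
      have "\<forall>k. \<exists>s. s \<in> D \<and> red (real_vec s) = real_vec s \<and>
          \<theta> * (\<psi> \<bullet> real_vec s + A) + real (Suc k) * (F s - p \<bullet> real_vec s - \<alpha>) < L (real_vec s) + \<beta>"
      proof
        fix k
        show "\<exists>s. s \<in> D \<and> red (real_vec s) = real_vec s \<and>
          \<theta> * (\<psi> \<bullet> real_vec s + A) + real (Suc k) * (F s - p \<bullet> real_vec s - \<alpha>) < L (real_vec s) + \<beta>"
          using neg[unfolded not_ex, rule_format, of "real (Suc k)"] by (simp add: not_le del: of_nat_Suc) blast
      qed
      then obtain s where s: "\<And>k. s k \<in> D" "\<And>k. red (real_vec (s k)) = real_vec (s k)"
         "\<And>k. \<theta> * (\<psi> \<bullet> real_vec (s k) + A) + real (Suc k) * (F (s k) - p \<bullet> real_vec (s k) - \<alpha>) < L (real_vec (s k)) + \<beta>"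
        by metis
      obtain B where B: "B \<ge> 0" "\<And>v. \<bar>L v\<bar> \<le> norm v * B"
        using bounded_linear.nonneg_bounded[OF blL] by auto
      define C where "C = B + \<bar>\<beta>\<bar> + \<theta> * (norm \<psi> + \<bar>A\<bar>)"
      have C: "0 \<le> C" using B(1) \<theta> by (simp add: C_def)
      have "(F (s k) - p \<bullet> real_vec (s k) - \<alpha>) * real (Suc k) \<le> C * (1 + norm (real_vec (s k)))" for k
      proof -
        let ?v = "real_vec (s k)"
        have "- (\<psi> \<bullet> ?v + A) \<le> norm \<psi> * norm ?v + \<bar>A\<bar>"
          using Cauchy_Schwarz_ineq2[of \<psi> ?v] by linarith
        then have "- (\<psi> \<bullet> ?v + A) \<le> (norm \<psi> + \<bar>A\<bar>) * (1 + norm ?v)"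
          by (simp add: algebra_simps) (smt (verit) mult_nonneg_nonneg norm_ge_zero)
        then have "\<theta> * (- (\<psi> \<bullet> ?v + A)) \<le> \<theta> * ((norm \<psi> + \<bar>A\<bar>) * (1 + norm ?v))"
          using \<theta> by (intro mult_left_mono) auto
        moreover have "L ?v + \<beta> \<le> (B + \<bar>\<beta>\<bar>) * (1 + norm ?v)"
          using B(2)[of ?v] B(1) by (simp add: algebra_simps) (smt (verit) mult_nonneg_nonneg norm_ge_zero)
        ultimately have "L ?v + \<beta> - \<theta> * (\<psi> \<bullet> ?v + A) \<le> C * (1 + norm ?v)"
          by (simp add: C_def algebra_simps)
        then show ?thesis using s(3)[of k] by (simp add: mult.commute del: of_nat_Suc)
      qed
      from ray_limit[OF p s(1) C this] show False
      proof (elim disjE exE conjE bexE)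
        fix t assume t: "t \<in> tight p \<alpha>" "\<exists>\<^sub>F k in sequentially. s k = t"
        then obtain k where k: "s k = t" using frequently_ex by blast
        have "0 \<le> \<theta> * (\<psi> \<bullet> real_vec t + A)" using A[OF t(1)] s(2)[of k] k \<theta> by simp
        moreover have "F t - p \<bullet> real_vec t - \<alpha> = 0" using t(1) by (simp add: tight_def)
        ultimately show False using s(3)[of k] tight[OF t(1)] k by simp
      next
        fix r d assume r: "norm d = 1" "recdir p d"
          "filterlim (\<lambda>k. norm (real_vec (s (r k)))) at_top sequentially"
          "(\<lambda>k. (1 / norm (real_vec (s (r k)))) *\<^sub>R real_vec (s (r k))) \<longlonglongrightarrow> d"
        define \<nu> where "\<nu> k = norm (real_vec (s (r k)))" for k
        have inv: "(\<lambda>k. 1 / \<nu> k) \<longlonglongrightarrow> 0"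
          using tendsto_inverse_0_at_top[OF r(3)] by (simp add: inverse_eq_divide \<nu>_def)
        have lim: "(\<lambda>k. (1 / \<nu> k) *\<^sub>R real_vec (s (r k))) \<longlonglongrightarrow> d" using r(4) by (simp add: \<nu>_def)
        have "(\<lambda>k. L ((1 / \<nu> k) *\<^sub>R real_vec (s (r k))) + \<beta> * (1 / \<nu> k) -
            \<theta> * (\<psi> \<bullet> ((1 / \<nu> k) *\<^sub>R real_vec (s (r k))) + A * (1 / \<nu> k))) \<longlonglongrightarrow>
            L d + \<beta> * 0 - \<theta> * (\<psi> \<bullet> d + A * 0)"
          by (intro tendsto_intros bounded_linear.tendsto[OF blL] lim inv)
        moreover have "0 \<le> L ((1 / \<nu> k) *\<^sub>R real_vec (s (r k))) + \<beta> * (1 / \<nu> k) -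
            \<theta> * (\<psi> \<bullet> ((1 / \<nu> k) *\<^sub>R real_vec (s (r k))) + A * (1 / \<nu> k))" for k
        proof -
          let ?v = "real_vec (s (r k))"
          have "0 \<le> F (s (r k)) - p \<bullet> ?v - \<alpha>" using p s(1)[of "r k"] by (force simp: minorant_def)
          then have "0 \<le> real (Suc (r k)) * (F (s (r k)) - p \<bullet> ?v - \<alpha>)" by simp
          then have "0 \<le> L ?v + \<beta> - \<theta> * (\<psi> \<bullet> ?v + A)" using s(3)[of "r k"] by linarith
          then have "0 \<le> (1 / \<nu> k) * (L ?v + \<beta> - \<theta> * (\<psi> \<bullet> ?v + A))" by (simp add: \<nu>_def)
          then show ?thesis by (simp add: linear_cmul[OF L(1)] diff_divide_distrib add_divide_distrib algebra_simps)
        qed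
        ultimately have "0 \<le> L d + \<beta> * 0 - \<theta> * (\<psi> \<bullet> d + A * 0)" by (intro LIMSEQ_le_const) auto
        moreover have "d \<in> K" by (rule K_limit[OF r(2) _ r(4)]) (rule s(2))
        then have "0 < \<theta> * (\<psi> \<bullet> d)" using \<psi> r(1) \<theta> by simp
        ultimately show False using L(2)[OF r(2)] by simp
      qed
    qed
    then obtain B where B: "B \<ge> 0" "\<And>s. s \<in> D \<Longrightarrow> red (real_vec s) = real_vec s \<Longrightarrow>
        L (real_vec s) + \<beta> \<le> \<theta> * (\<psi> \<bullet> real_vec s + A) + B * (F s - p \<bullet> real_vec s - \<alpha>)" by blast
    have "(\<lambda>v. L v - \<theta> * (\<psi> \<bullet> red v)) x + (\<beta> - \<theta> * A) \<le> B * (p \<bullet> x + \<alpha> - p \<bullet> x - \<alpha>)"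
    proof (rule epi_hull_le[OF _ B(1) _ x])
      show "linear (\<lambda>v. L v - \<theta> * (\<psi> \<bullet> red v))"
        by (rule linearI) (simp_all add: linear_add[OF L(1)] linear_add[OF linred] linear_cmul[OF L(1)]
            linear_cmul[OF linred] inner_add_right algebra_simps)
      fix s assume s: "s \<in> D"
      \<comment> \<open>An arbitrary \<open>s\<close> is replaced by \<open>redi s\<close>, which
        leaves \<open>L\<close> unchanged and does not increase the gap.\<close>
      have "L (real_vec s) + \<beta> \<le> \<theta> * (\<psi> \<bullet> red (real_vec s) + A) + B * (F (redi s) - p \<bullet> real_vec (redi s) - \<alpha>)"
        using B(2)[OF _ redi_red, of s] redi_D[OF s] L_red[of s] by (simp add: rv_red)
      also have "\<dots> \<le> \<theta> * (\<psi> \<bullet> red (real_vec s) + A) + B * (F s - p \<bullet> real_vec s - \<alpha>)"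
        using redi_D[OF s] B(1) by (intro add_left_mono mult_left_mono) auto
      finally show "L (real_vec s) - \<theta> * (\<psi> \<bullet> red (real_vec s)) + (\<beta> - \<theta> * A) \<le> B * (F s - p \<bullet> real_vec s - \<alpha>)"
        by (simp add: algebra_simps)
    qed
    then show ?thesis by (simp add: algebra_simps)
  qed
  show ?thesis
  proof (rule ccontr)
    assume "\<not> ?thesis"
    then have pos: "0 < L x + \<beta>" by simp
    \<comment> \<open>For a positive \<open>c\<close> above
      \<open>\<psi> \<bullet> red x + A\<close>, the choice
      \<open>\<theta> = (L x + \<beta>) / c\<close> contradicts \<open>bound\<close>.\<close>
    define c where "c = \<bar>\<psi> \<bullet> red x + A\<bar> + 1"
    have c: "0 < c" "\<psi> \<bullet> red x + A < c" by (simp_all add: c_def)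
    have "(L x + \<beta>) / c * (\<psi> \<bullet> red x + A) < (L x + \<beta>) / c * c"
      using pos c by (intro mult_strict_left_mono) auto
    moreover have "L x + \<beta> \<le> (L x + \<beta>) / c * (\<psi> \<bullet> red x + A)"
      using bound[of "(L x + \<beta>) / c"] pos c(1) by simp
    ultimately show False using c(1) by simp
  qed
qed

text \<open>Here \<open>L\<close> is the difference of two partial sums; the recession hypothesis of
  \<open>linear_le_at_touch\<close> is \<open>recdir_psum_le\<close> at a contact point where this
  difference is maximal.\<close>

lemma touch_extensible:
  assumes p: "minorant p \<alpha>" and x: "(x, p \<bullet> x + \<alpha>) \<in> epi_hull"
    and le: "\<And>s. s \<in> tight p \<alpha> \<Longrightarrow> psum s j - psum s i \<le> c"
  shows "psum x j - psum x i \<le> real_of_int c"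
proof -
  \<comment> \<open>With \<open>L = 0\<close> and the constant 1, an empty contact set would give
    \<open>1 \<le> 0\<close>.\<close>
  have "tight p \<alpha> \<noteq> {}"
    using linear_le_at_touch[OF p x, of "\<lambda>_. 0" 1] by (auto simp: linear_zero)
  then obtain u where u: "u \<in> tight p \<alpha>" by blast
  let ?w = "\<lambda>s. nat (c - (psum s j - psum s i))"
  obtain v where v: "v \<in> tight p \<alpha>" "\<And>s. s \<in> tight p \<alpha> \<Longrightarrow> ?w v \<le> ?w s"
    using ex_has_least_nat[of "\<lambda>s. s \<in> tight p \<alpha>" u ?w] u by blast
  have max: "psum s j - psum s i \<le> psum v j - psum v i" if "s \<in> tight p \<alpha>" for s
    using v(2)[OF that] le[OF that] le[OF v(1)] by linarith
  have "psum x j - psum x i + - real_of_int (psum v j - psum v i) \<le> 0"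
  proof (rule linear_le_at_touch[OF p x, of "\<lambda>x. psum x j - psum x i"])
    show "linear (\<lambda>x. psum x j - psum x i :: real)"
      by (intro linear_compose_sub bounded_linear.linear[OF bounded_linear_psum])
    show "psum d j - psum d i \<le> 0" if "recdir p d" for d
      using recdir_psum_le[OF p v(1) that max] by simp
    show "psum (real_vec s) j - psum (real_vec s) i + - real_of_int (psum v j - psum v i) \<le> 0"
      if "s \<in> tight p \<alpha>" for s
      using max[OF that] by (simp add: psum_real_vec flip: of_int_diff)
  qed
  then show ?thesis using le[OF v(1)] by simp
qed

end

section \<open>Proof of the theorem\<close>

lemma polyhedron_Times_UNIV:
  fixes P :: "'a::euclidean_space set"
  assumes "polyhedron P"
  shows "polyhedron (P \<times> (UNIV :: 'b::euclidean_space set))"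
proof -
  obtain \<F> where \<F>: "finite \<F>" "P = \<Inter>\<F>" "\<forall>h\<in>\<F>. \<exists>a b. a \<noteq> 0 \<and> h = {x. a \<bullet> x \<le> b}"
    using assms by (auto simp: polyhedron_def)
  have "\<exists>a b. a \<noteq> 0 \<and> h \<times> (UNIV :: 'b set) = {x. a \<bullet> x \<le> b}" if h: "h \<in> \<F>" for h
  proof -
    obtain a b where "a \<noteq> 0" "h = {x. a \<bullet> x \<le> b}" using \<F>(3) h by blast
    then show ?thesis by (intro exI[of _ "(a, 0)"] exI[of _ b]) (auto simp: zero_prod_def)
  qed
  moreover have "P \<times> (UNIV :: 'b set) = \<Inter>((\<lambda>h. h \<times> UNIV) ` \<F>)"
    unfolding \<F>(2) by (intro set_eqI) (simp add: mem_Times_iff)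
  ultimately show ?thesis
    unfolding polyhedron_def
    by (intro exI[of _ "(\<lambda>h. h \<times> UNIV) ` \<F>"] conjI ballI) (use \<F>(1) in \<open>simp, simp, blast\<close>)
qed

text \<open>Upward closure excludes half-spaces that bound \<tau> from above. Those that bound it
  from below are the affine pieces, and the vertical ones do not involve \<tau>; so over each point
  of the projection the largest piece is attained.\<close>

lemma polyhedral_epigraph:
  fixes Q :: "('a::euclidean_space \<times> real) set"
  assumes Q: "polyhedron Q" and up: "\<And>x \<tau> \<tau>'. (x, \<tau>) \<in> Q \<Longrightarrow> \<tau> \<le> \<tau>' \<Longrightarrow> (x, \<tau>') \<in> Q"
    and low: "\<And>x. \<exists>\<tau>. (x, \<tau>) \<notin> Q"
  shows "\<exists>M. finite M \<and> (\<forall>(q, \<beta>)\<in>M. \<forall>(x, \<tau>)\<in>Q. q \<bullet> x + \<beta> \<le> \<tau>) \<and>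
    (\<forall>(x, \<tau>)\<in>Q. \<exists>(q, \<beta>)\<in>M. (x, q \<bullet> x + \<beta>) \<in> Q)"
proof (cases "Q = {}")
  case True
  then show ?thesis by (intro exI[of _ "{}"]) auto
next
  case False
  then obtain x0 \<tau>0 where x0: "(x0, \<tau>0) \<in> Q" by auto
  obtain \<F> where \<F>: "finite \<F>" "Q = \<Inter>\<F>" "\<forall>h\<in>\<F>. \<exists>a b. a \<noteq> 0 \<and> h = {x. a \<bullet> x \<le> b}"
    using Q by (auto simp: polyhedron_def)
  have "\<forall>h\<in>\<F>. \<exists>abc. \<forall>z. z \<in> h \<longleftrightarrow> (fst abc, fst (snd abc)) \<bullet> z \<le> snd (snd abc)"
  proof
    fix h assume "h \<in> \<F>"
    then obtain a b where "h = {x. a \<bullet> x \<le> b}" using \<F>(3) by blast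
    then show "\<exists>abc. \<forall>z. z \<in> h \<longleftrightarrow> (fst abc, fst (snd abc)) \<bullet> z \<le> snd (snd abc)"
      by (intro exI[of _ "(fst a, snd a, b)"]) simp
  qed
  from bchoice[OF this] obtain w where
    w: "\<And>h z. h \<in> \<F> \<Longrightarrow> z \<in> h \<longleftrightarrow> (fst (w h), fst (snd (w h))) \<bullet> z \<le> snd (snd (w h))" by blast
  define a c b where "a h = fst (w h)" and "c h = - fst (snd (w h))" and "b h = snd (snd (w h))" for h
  have inQ: "(x, \<tau>) \<in> Q \<longleftrightarrow> (\<forall>h\<in>\<F>. a h \<bullet> x - c h * \<tau> \<le> b h)" for x \<tau>
  proof -
    have "(x, \<tau>) \<in> h \<longleftrightarrow> a h \<bullet> x - c h * \<tau> \<le> b h" if "h \<in> \<F>" for h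
      by (simp add: w[OF that] a_def b_def c_def)
    then show ?thesis using \<F>(2) by auto
  qed
  have c: "0 \<le> c h" if "h \<in> \<F>" for h
  proof (rule ccontr)
    assume "\<not> 0 \<le> c h"
    then obtain n where "b h - (a h \<bullet> x0 - c h * \<tau>0) < real n * (- c h)"
      using reals_Archimedean3[of "- c h"] by auto
    moreover have "(x0, \<tau>0 + real n) \<in> Q" by (rule up[OF x0]) simp
    ultimately show False using that by (fastforce simp: inQ algebra_simps)
  qed
  define H where "H = {h \<in> \<F>. c h \<noteq> 0}"
  define m where "m h x = (a h \<bullet> x - b h) / c h" for h x
  have cH: "0 < c h" if "h \<in> H" for h using c that by (force simp: H_def)
  have lower: "m h x \<le> \<tau>" if "h \<in> H" "(x, \<tau>) \<in> Q" for h x \<tau>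
  proof -
    have "a h \<bullet> x - c h * \<tau> \<le> b h" using that by (simp add: inQ H_def)
    then show ?thesis using cH[OF that(1)] by (simp add: m_def field_simps)
  qed
  have attained: "\<exists>h\<in>H. (x, m h x) \<in> Q" if x: "(x, \<tau>) \<in> Q" for x \<tau>
  proof -
    have "H \<noteq> {}"
    proof
      assume "H = {}"
      then have "(x, \<tau>') \<in> Q" for \<tau>' using x by (force simp: inQ H_def)
      then show False using low by blast
    qed
    then obtain h where h: "h \<in> H" "\<And>k. k \<in> H \<Longrightarrow> m k x \<le> m h x"
      using \<F>(1) Max_in[of "(\<lambda>h. m h x) ` H"] Max_ge[of "(\<lambda>h. m h x) ` H"] by (fastforce simp: H_def)
    have "a k \<bullet> x - c k * m h x \<le> b k" if k: "k \<in> \<F>" for k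
    proof (cases "c k = 0")
      case True
      then show ?thesis using x k by (force simp: inQ)
    next
      case False
      then have "k \<in> H" using k by (simp add: H_def)
      then show ?thesis using h(2)[of k] cH[of k] by (simp add: m_def[of k] field_simps)
    qed
    then show ?thesis using h(1) by (auto simp: inQ)
  qed
  let ?M = "(\<lambda>h. ((1 / c h) *\<^sub>R a h, - b h / c h)) ` H"
  have m: "((1 / c h) *\<^sub>R a h) \<bullet> x - b h / c h = m h x" for h x
    by (simp add: m_def diff_divide_distrib)
  show ?thesis
    by (intro exI[of _ ?M] conjI) (use \<F>(1) lower attained in \<open>auto simp: H_def m simp del: inner_scaleR_left\<close>)
qed

lemma closed_if_closed_boxes:
  fixes G :: "('a::euclidean_space \<times> 'b::euclidean_space) set"
  assumes "\<And>a b. closed (G \<inter> cbox a b \<times> UNIV)"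
  shows "closed G"
  unfolding closed_sequential_limits
proof (intro allI impI, elim conjE)
  fix z :: "nat \<Rightarrow> 'a \<times> 'b" and l
  assume z: "\<forall>n. z n \<in> G" "z \<longlonglongrightarrow> l"
  have "fst l \<in> box (fst l - One) (fst l + One)" by (simp add: mem_box inner_diff_left inner_add_left)
  then have "\<forall>\<^sub>F n in sequentially. fst (z n) \<in> box (fst l - One) (fst l + One)"
    by (rule topological_tendstoD[OF tendsto_fst[OF z(2)] open_box])
  then have "\<forall>\<^sub>F n in sequentially. z n \<in> G \<inter> cbox (fst l - One) (fst l + One) \<times> UNIV"
    by (rule eventually_mono) (use z(1) box_subset_cbox in \<open>auto simp: mem_Times_iff\<close>)
  from Lim_in_closed_set[OF assms this _ z(2)] show "l \<in> G" by simp
qed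

lemma argmin_tilt_eq:
  assumes "\<And>x. f x \<noteq> -\<infinity>" "eff_dom f \<noteq> {}"
  shows "argmin_set (tilt f p) = {t \<in> eff_dom f. \<forall>s\<in>eff_dom f.
    real_of_ereal (f t) - p \<bullet> real_vec t \<le> real_of_ereal (f s) - p \<bullet> real_vec s}"
proof -
  have dot: "(\<Sum>i\<in>UNIV. p $ i * real_of_int (x $ i)) = p \<bullet> real_vec x" for x
    by (simp add: inner_vec_def real_vec_def)
  have fin: "f x = ereal (real_of_ereal (f x))" if "x \<in> eff_dom f" for x
    using that assms(1)[of x] by (cases "f x") (auto simp: eff_dom_def)
  have t_in: "tilt f p x = ereal (real_of_ereal (f x) - p \<bullet> real_vec x)" if "x \<in> eff_dom f" for x
    unfolding tilt_def dot by (subst fin[OF that]) simp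
  have t_out: "tilt f p x = \<infinity>" if "x \<notin> eff_dom f" for x
    using that by (simp add: tilt_def eff_dom_def)
  have "x \<in> argmin_set (tilt f p) \<longleftrightarrow> (\<forall>y. tilt f p x \<le> tilt f p y)" for x
    by (auto simp: argmin_set_def is_arg_min_def not_less)
  also have "\<dots> x \<longleftrightarrow> x \<in> eff_dom f \<and> (\<forall>y\<in>eff_dom f. tilt f p x \<le> tilt f p y)" for x
  proof -
    obtain y where "y \<in> eff_dom f" using assms(2) by blast
    then show ?thesis
      by (metis t_in t_out ereal_infty_less_eq(1) ereal_less_eq(1) PInfty_neq_ereal(1))
  qed
  finally show ?thesis by (auto simp: t_in)
qed

text \<open>A multimodular set is nonempty by definition, whereas the minimum may fail to be
  attained when the domain is infinite; the condition therefore ranges over those \<open>p\<close>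
  for which minimizers exist.\<close>

theorem theorem5p3:
  fixes f :: "int ^ ('n::{finite,linorder}) \<Rightarrow> ereal"
  assumes "\<And>x. f x \<noteq> -\<infinity>"
    and "eff_dom f \<noteq> {}"
    and "bounded (real_vec ` eff_dom f) \<or>
         (polyhedron (convex hull (real_vec ` eff_dom f)) \<and> convex_extensible f)"
  shows "multimodular f \<longleftrightarrow>
         (\<forall>p :: real ^ ('n::{finite,linorder}). argmin_set (tilt f p) \<noteq> {} \<longrightarrow>
                            multimodular_set (argmin_set (tilt f p)))"
proof -
  define D where "D = eff_dom f"
  define F where "F x = real_of_ereal (f x)" for x
  have fin: "f x = ereal (F x)" if "x \<in> D" for x
    using that assms(1)[of x] by (cases "f x") (auto simp: eff_dom_def D_def F_def)
  have out: "f x = \<infinity>" if "x \<notin> D" for x using that by (simp add: eff_dom_def D_def)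
  have amin: "argmin_set (tilt f p) = {t \<in> D. \<forall>s\<in>D. F t - p \<bullet> real_vec t \<le> F s - p \<bullet> real_vec s}" for p
    using argmin_tilt_eq[OF assms(1,2), of p] by (simp add: D_def F_def)
  have mm: "multimodular f \<longleftrightarrow> (\<forall>a b. diffs a \<in> D \<longrightarrow> diffs b \<in> D \<longrightarrow>
      diffs (\<lambda>i. max (a i) (b i)) \<in> D \<and> diffs (\<lambda>i. min (a i) (b i)) \<in> D \<and>
      F (diffs (\<lambda>i. max (a i) (b i))) + F (diffs (\<lambda>i. min (a i) (b i))) \<le> F (diffs a) + F (diffs b))"
  proof -
    have "f x + f y \<le> f u + f v \<longleftrightarrow> (u \<in> D \<longrightarrow> v \<in> D \<longrightarrow> x \<in> D \<and> y \<in> D \<and> F x + F y \<le> F u + F v)"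
      for x y u v
      by (cases "u \<in> D"; cases "v \<in> D"; cases "x \<in> D"; cases "y \<in> D") (simp_all add: fin out)
    then show ?thesis using assms(1,2) by (simp add: multimodular_def submodular_tilde_iff)
  qed
  show ?thesis
  proof
    \<comment> \<open>The linear form has the same total on max and min as on \<open>a\<close> and
      \<open>b\<close>, so submodularity makes max and min minimizers as well.\<close>
    assume f: "multimodular f"
    have "lset (argmin_set (tilt f p))" for p
      unfolding lset_def
    proof (intro allI impI)
      fix a b :: "'n option \<Rightarrow> int"
      assume a: "diffs a \<in> argmin_set (tilt f p)" and b: "diffs b \<in> argmin_set (tilt f p)"
      let ?u = "diffs (\<lambda>i. max (a i) (b i))" and ?v = "diffs (\<lambda>i. min (a i) (b i))"
      have D: "?u \<in> D" "?v \<in> D" and le: "F ?u + F ?v \<le> F (diffs a) + F (diffs b)"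
        using f a b unfolding mm amin by blast+
      have "real_vec ?u + real_vec ?v = real_vec (diffs (\<lambda>i. max (a i) (b i) + min (a i) (b i)))"
        by (simp only: diffs_add real_vec_add)
      also have "(\<lambda>i. max (a i) (b i) + min (a i) (b i)) = (\<lambda>i. a i + b i)" by auto
      finally have "p \<bullet> real_vec ?u + p \<bullet> real_vec ?v = p \<bullet> real_vec (diffs a) + p \<bullet> real_vec (diffs b)"
        by (simp add: diffs_add real_vec_add flip: inner_add_right)
      then show "?u \<in> argmin_set (tilt f p) \<and> ?v \<in> argmin_set (tilt f p)"
        using a b le D unfolding amin by (smt (verit) mem_Collect_eq)
    qed
    then show "\<forall>p. argmin_set (tilt f p) \<noteq> {} \<longrightarrow> multimodular_set (argmin_set (tilt f p))"
      using lset_imp_multimodular_set by blast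
  next
    assume "\<forall>p. argmin_set (tilt f p) \<noteq> {} \<longrightarrow> multimodular_set (argmin_set (tilt f p))"
    then have "lset (argmin_set (tilt f p))" for p
      by (cases "argmin_set (tilt f p) = {}") (auto simp: lset_def[of "{}"] intro: multimodular_set_imp_lset)
    then interpret argmin_lsets D F by unfold_locales (simp add: amin)
    show "multimodular f"
    proof (cases "finite D")
      case True
      have "minorant 0 (Min (F ` D))" using True by (simp add: minorant_def)
      from submodular_if_touch[OF this] show ?thesis
        unfolding mm by (simp add: touch_finite[OF True])
    next
      case False
      then have "\<not> bounded (real_vec ` D)" using finite_lattice_of_bounded by blast
      then have P: "polyhedron (convex hull (real_vec ` D))" and "convex_extensible f"
        using assms(3) by (auto simp: D_def)
      then obtain g where g: "\<And>x. g x \<noteq> -\<infinity>" "convex (epi g)"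
          "\<And>a b. polyhedron (epi (\<lambda>x. if x \<in> cbox a b then g x else \<infinity>))"
        and gf: "\<And>x. g (real_vec x) = f x"
        unfolding convex_extensible_def locally_polyhedral_convex_def by blast
      \<comment> \<open>The extension may be finite outside the hull of \<open>D\<close>. Since the
        hull is a polyhedron, cutting the epigraph down to it keeps the part over every box
        polyhedral.\<close>
      define G where "G = epi g \<inter> (convex hull (real_vec ` D)) \<times> UNIV"
      have inG: "(x, \<tau>) \<in> G \<longleftrightarrow> g x \<le> ereal \<tau> \<and> x \<in> convex hull (real_vec ` D)" for x \<tau>
        by (simp add: G_def epi_def)
      have poly: "polyhedron (G \<inter> cbox a b \<times> UNIV)" for a b
      proof -
        have "G \<inter> cbox a b \<times> UNIV =
            epi (\<lambda>x. if x \<in> cbox a b then g x else \<infinity>) \<inter> (convex hull (real_vec ` D)) \<times> UNIV"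
          by (auto simp: G_def epi_def split: if_splits)
        then show ?thesis using g(3) P by (simp add: polyhedron_Times_UNIV)
      qed
      interpret extensible_lsets D F G
      proof
        show "convex G" unfolding G_def by (intro convex_Int g(2) convex_Times convex_convex_hull convex_UNIV)
        show "closed G" by (rule closed_if_closed_boxes) (rule polyhedron_imp_closed[OF poly])
        show "(real_vec t, F t) \<in> G" if "t \<in> D" for t
          using that by (simp add: inG gf fin hull_inc)
        show "t \<in> D \<and> F t \<le> \<tau>" if "(real_vec t, \<tau>) \<in> G" for t \<tau>
          using that by (cases "t \<in> D") (auto simp: inG gf fin out)
        show "x \<in> convex hull (real_vec ` D)" if "(x, \<tau>) \<in> G" for x \<tau>
          using that by (simp add: inG)
        fix u assume "u \<in> D"
        let ?B = "cbox (real_vec u - One) (real_vec u + One)"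
        have "\<exists>\<tau>. (x, \<tau>) \<notin> G \<inter> ?B \<times> UNIV" for x
          using g(1)[of x] ereal_bot by (auto simp: inG)
        moreover have "(x, \<tau>') \<in> G \<inter> ?B \<times> UNIV" if "(x, \<tau>) \<in> G \<inter> ?B \<times> UNIV" "\<tau> \<le> \<tau>'" for x \<tau> \<tau>'
          using that order_trans[of "g x" "ereal \<tau>" "ereal \<tau>'"] by (auto simp: inG)
        ultimately have "\<exists>M. finite M \<and> (\<forall>(q, \<beta>)\<in>M. \<forall>(x, \<tau>)\<in>G \<inter> ?B \<times> UNIV. q \<bullet> x + \<beta> \<le> \<tau>) \<and>
            (\<forall>(x, \<tau>)\<in>G \<inter> ?B \<times> UNIV. \<exists>(q, \<beta>)\<in>M. (x, q \<bullet> x + \<beta>) \<in> G \<inter> ?B \<times> UNIV)"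
          by (rule polyhedral_epigraph[OF poly, rotated])
        then show "\<exists>M. finite M \<and> (\<forall>(q, \<beta>)\<in>M. \<forall>(x, \<tau>)\<in>G. x \<in> ?B \<longrightarrow> q \<bullet> x + \<beta> \<le> \<tau>) \<and>
            (\<forall>(x, \<tau>)\<in>G. x \<in> ?B \<longrightarrow> (\<exists>(q, \<beta>)\<in>M. (x, q \<bullet> x + \<beta>) \<in> G))"
          by (rule ex_forward) (simp add: case_prod_beta mem_Times_iff)
      qed
      obtain u where "u \<in> D" using False by fastforce
      then obtain q \<beta> where "minorant q \<beta>" by (rule ex_subgradient)
      from submodular_if_touch[OF this] show ?thesis
        unfolding mm by (simp add: touch_extensible)
    qed
  qed
qed

end
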